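(* Let $i\ge 1$ be a fixed integer. The following hold for functions $m=m(n)\ge i$. (1) If $m=o(\ln n)$ as $n\to\infty$, then $$\max_{A \in \mathcal{S}^n}\ \mathbb{P}_{b \sim \mathcal{U}(S^{n-1})} \left[ \frac{\lambda_i(A) - \lambda_i^{(m)}(A,b)}{\lambda_1(A)-\lambda_n(A)} \ge 1-o(1) \right] \ge 1 - o(1/n).$$ (2) If $m=\Theta(\ln n)$ as $n\to\infty$, then $$\max_{A \in \mathcal{S}^n}\ \mathbb{P}_{b \sim \mathcal{U}(S^{n-1})} \left[ \frac{\lambda_i(A) - \lambda_i^{(m)}(A,b)}{\lambda_1(A)-\lambda_n(A)} \ge \frac{.015 \ln^2 n}{ m^2 \ln^2 \ln n} \right] \ge 1 - o(1/n).$$ (3) If $m=o\left(n^{1/2}\ln^{-1/2}n\right)$ and $m=\omega(1)$ as $n\to\infty$, then $$\max_{A \in \mathcal{S}^n}\ \mathbb{P}_{b \sim \mathcal{U}(S^{n-1})} \left[ \frac{\lambda_i(A) - \lambda_i^{(m)}(A,b)}{\lambda_1(A)-\lambda_n(A)} \ge \frac{1.08}{m^2} \right] \ge 1 - o(1/n).$$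
   Context: $\mathcal{S}^n$ is the set of real symmetric $n\times n$ matrices; the eigenvalues of $A\in\mathcal{S}^n$, with multiplicity, are $\lambda_1(A)\ge\dots\ge\lambda_n(A)$. $\mathcal{U}(S^{n-1})$ is the uniform probability measure on $S^{n-1}=\{x\in\mathbb{R}^n : \|x\|=1\}$. For a positive integer $m$ and nonzero $b\in\mathbb{R}^n$, the Krylov subspace is $\mathcal{K}_m(A,b)=\mathrm{span}\{b,Ab,\dots,A^{m-1}b\}$, and the $i$-th Ritz value (the approximation of $\lambda_i(A)$ after $m$ iterations of the Lanczos method) is $$\lambda_i^{(m)}(A,b)=\max_{\substack{U\subset\mathcal{K}_m(A,b)\\ \dim U=i}}\ \min_{x\in U,\,x\neq0}\frac{x^TAx}{x^Tx},$$ where $U$ ranges over linear subspaces; it is defined when $\dim\mathcal{K}_m(A,b)\ge i$. The events in the probabilities are understood to require that $\lambda_i^{(m)}(A,b)$ is defined. The quotient is taken to be $0$ when $\lambda_1(A)=\lambda_n(A)$. "Max" over $A\in\mathcal{S}^n$ is read as a supremum. Asymptotic notation is as $n\to\infty$, with $m=m(n)$ positive-integer-valued: $f=o(g)$ means $f(n)/g(n)\to0$; $f=\omega(g)$ means $g=o(f)$; $f=\Theta(g)$ means $f=O(g)$ and $g=O(f)$. Given $i$ and the function $m(n)$, each claim says there is a sequence $\eta_n$ with $n\eta_n\to0$ (and in (1) also a sequence $\varepsilon_n\to0$) such that the inequality holds for all sufficiently large $n$ with $o(1/n)$ replaced by $\eta_n$ (and $o(1)$ replaced by $\varepsilon_n$).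 *)

theory Defs
  imports
    "HOL-Probability.Probability"
    "HOL-Library.Landau_Symbols"
    "HOL-Computational_Algebra.Computational_Algebra"
    "Jordan_Normal_Form.Char_Poly"
    "Jordan_Normal_Form.VS_Connect"
begin

text \<open>
  As the dimension \<open>n\<close> tends to infinity, \<open>\<real>\<^sup>n\<close> is \<open>carrier_vec n\<close> and the real \<open>n \<times> n\<close> matrices
  are \<open>carrier_mat n n\<close>. Both \<open>vec\<close> and \<open>subspace\<close> exist also in other library theories, hence the
  qualified names.
\<close>

definition sym_mats :: "nat \<Rightarrow> real mat set" where
  "sym_mats n = {A \<in> carrier_mat n n. transpose_mat A = A}"

text \<open>
  \<open>eigval A i\<close> is the \<open>i\<close>-th largest eigenvalue, counted from 1 and with multiplicity. For a
  symmetric \<open>A\<close> of size \<open>n\<close> the multiset of real roots of the characteristic polynomial has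
  exactly \<open>n\<close> elements; the value is meaningful for \<open>1 \<le> i \<le> n\<close>.
\<close>
definition eigval :: "real mat \<Rightarrow> nat \<Rightarrow> real" where
  "eigval A i = rev (sorted_list_of_multiset (proots (char_poly A))) ! (i - 1)"

abbreviation vec_span :: "nat \<Rightarrow> real Matrix.vec set \<Rightarrow> real Matrix.vec set" where
  "vec_span n \<equiv> LinearCombinations.module.span class_ring (module_vec TYPE(real) n)"

abbreviation vec_subspace :: "nat \<Rightarrow> real Matrix.vec set \<Rightarrow> bool" where
  "vec_subspace n U \<equiv> VectorSpace.subspace class_ring U (module_vec TYPE(real) n)"

abbreviation vec_subspace_dim :: "nat \<Rightarrow> real Matrix.vec set \<Rightarrow> nat" where
  "vec_subspace_dim n U \<equiv> vectorspace.dim class_ring (module_vec TYPE(real) n\<lparr>carrier := U\<rparr>)"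

definition krylov :: "real mat \<Rightarrow> real Matrix.vec \<Rightarrow> nat \<Rightarrow> real Matrix.vec set" where
  "krylov A b m = vec_span (dim_row A) {(A ^\<^sub>m k) *\<^sub>v b | k. k < m}"

definition rayleigh :: "real mat \<Rightarrow> real Matrix.vec \<Rightarrow> real" where
  "rayleigh A x = scalar_prod x (A *\<^sub>v x) / scalar_prod x x"

definition ritz_defined :: "real mat \<Rightarrow> real Matrix.vec \<Rightarrow> nat \<Rightarrow> nat \<Rightarrow> bool" where
  "ritz_defined A b m i \<longleftrightarrow> i \<le> vec_subspace_dim (dim_row A) (krylov A b m)"

text \<open>
  The maximum and the minimum of the max-min formula are attained for symmetric \<open>A\<close> and \<open>i \<ge> 1\<close>
  whenever \<open>ritz_defined A b m i\<close> holds, so they are written as \<open>Sup\<close> and \<open>Inf\<close> (of nonempty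
  bounded sets). Otherwise the value is junk.
\<close>
definition ritz :: "real mat \<Rightarrow> real Matrix.vec \<Rightarrow> nat \<Rightarrow> nat \<Rightarrow> real" where
  "ritz A b m i =
     (SUP U \<in> {U. vec_subspace (dim_row A) U \<and> U \<subseteq> krylov A b m
                    \<and> vec_subspace_dim (dim_row A) U = i}.
        INF x \<in> U - {0\<^sub>v (dim_row A)}. rayleigh A x)"

text \<open>If \<open>A\<close> has only one eigenvalue, this is \<open>0\<close>, as \<open>x / 0 = 0\<close>.\<close>
definition rel_error :: "real mat \<Rightarrow> real Matrix.vec \<Rightarrow> nat \<Rightarrow> nat \<Rightarrow> real" where
  "rel_error A b m i = (eigval A i - ritz A b m i) / (eigval A 1 - eigval A (dim_row A))"

definition unit_sphere :: "nat \<Rightarrow> real Matrix.vec set" where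
  "unit_sphere n = {x \<in> carrier_vec n. scalar_prod x x = 1}"

definition borel_vec :: "nat \<Rightarrow> real Matrix.vec measure" where
  "borel_vec n = vimage_algebra (carrier_vec n) (\<lambda>v. \<lambda>i\<in>{..<n}. vec_index v i)
                   (\<Pi>\<^sub>M i\<in>{..<n}. borel)"

text \<open>
  The uniform distribution on the unit sphere (normalised surface measure) is the law of \<open>x / \<parallel>x\<parallel>\<close>
  for \<open>x\<close> uniform, with respect to Lebesgue measure, in the unit ball without the origin. It is a
  probability measure on the Borel sets of the sphere for \<open>n \<ge> 1\<close>.
\<close>
definition uniform_sphere :: "nat \<Rightarrow> real Matrix.vec measure" where
  "uniform_sphere n = restrict_space
     (distr
        (uniform_measure (\<Pi>\<^sub>M i\<in>{..<n}. lborel)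
           {x \<in> space (\<Pi>\<^sub>M i\<in>{..<n}. lborel). 0 < (\<Sum>i<n. (x i)\<^sup>2) \<and> (\<Sum>i<n. (x i)\<^sup>2) \<le> 1})
        (borel_vec n)
        (\<lambda>x. Matrix.vec n (\<lambda>i. x i / sqrt (\<Sum>j<n. (x j)\<^sup>2))))
     (unit_sphere n)"

definition error_prob :: "nat \<Rightarrow> real mat \<Rightarrow> nat \<Rightarrow> nat \<Rightarrow> real \<Rightarrow> real" where
  "error_prob n A m i t = measure (uniform_sphere n)
     {b \<in> space (uniform_sphere n). ritz_defined A b m i \<and> rel_error A b m i \<ge> t}"

definition worst_error_prob :: "nat \<Rightarrow> nat \<Rightarrow> nat \<Rightarrow> real \<Rightarrow> real" where
  "worst_error_prob n m i t = (SUP A \<in> sym_mats n. error_prob n A m i t)"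

end

theory Submission
  imports Defs "HOL-Real_Asymp.Real_Asymp"
begin

text \<open>
  Only one matrix has to be exhibited for each \<open>n\<close>, and diagonal ones suffice. For \<open>A = diag d\<close> the Krylov
  subspace of \<open>b\<close> consists of the vectors with entries \<open>p (d j) b j\<close>, where \<open>p\<close> ranges over the polynomials of
  degree less than \<open>m\<close> (\<open>krylov_mat_diag\<close>).

  For \<open>i \<ge> 2\<close> repeated eigenvalues give all three claims at once, because a Krylov subspace has at most one
  dimension for each distinct eigenvalue. If \<open>A\<close> has exactly \<open>i\<close> distinct eigenvalues and the largest one has
  multiplicity at least \<open>i\<close>, then \<open>\<lambda>\<^sub>i = \<lambda>\<^sub>1\<close>, while the \<open>i\<close>-th Ritz value is the smallest eigenvalue whenever
  it is defined. The relative error is \<open>1\<close> almost surely (\<open>worst_error_prob_higher\<close>).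

  For \<open>i = 1\<close> the eigenvalue \<open>1\<close> is simple, and the others are the \<open>m\<close> Chebyshev nodes of an interval \<open>[0, r]\<close>,
  each with multiplicity about \<open>n / m\<close>. The largest Ritz value is at most \<open>1 - t\<close> if every \<open>p\<close> satisfies
  \<open>\<Sum>\<^sub>j (1 - t - d j) p (d j)\<^sup>2 (b j)\<^sup>2 \<ge> 0\<close>. The one negative term, \<open>- t p(1)\<^sup>2 (b 0)\<^sup>2\<close>, involves an
  extrapolation from the nodes to \<open>1\<close>. Since there are as many nodes as coefficients, \<open>p(1)\<close> is determined by the
  values at the nodes, and \<open>p(1)\<^sup>2 \<le> 4 m Z\<^sup>2\<^sup>m \<Sum>\<^sub>k p(x\<^sub>k)\<^sup>2\<close>, where \<open>Z\<close> is the growth rate of the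
  Chebyshev polynomials (\<open>cheb_extrapolation\<close>). So the error is at least \<open>t\<close> unless the single weight
  \<open>(b 0)\<^sup>2\<close> dominates the weight of one of the \<open>m\<close> nodes, which is a sum of about \<open>n / m\<close> squares
  (\<open>blocks_form_nonneg\<close>). This event is invariant under scaling of \<open>b\<close>, hence it has the same probability for
  a Gaussian vector, and a Chernoff bound shows that it has probability \<open>O(n\<^sup>-\<^sup>2)\<close> as long as
  \<open>m\<^sup>2 t Z\<^sup>2\<^sup>m ln n\<close> is at most a small multiple of \<open>(1 - t - r) n\<close>, and \<open>m ln n\<close> one of \<open>n\<close> (\<open>unif_ball_dominated_le\<close>,
  \<open>worst_error_prob_top_large\<close>).

  The three claims are choices of \<open>r\<close>. For \<open>t = 1 - \<epsilon>\<close> take \<open>r = \<epsilon> / 2\<close>; then \<open>Z \<le> 8 / \<epsilon>\<close>, and \<open>Z\<^sup>2\<^sup>m\<close> is a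
  small power of \<open>n\<close> if \<open>m = o(ln n)\<close> and \<open>\<epsilon>\<close> tends to \<open>0\<close> slowly. For \<open>t \<rightarrow> 0\<close> take \<open>r = 1 - 2 t\<close>; then
  \<open>Z = 1 + O(\<surd>t)\<close>, and \<open>Z\<^sup>2\<^sup>m\<close> is \<open>n\<^sup>o\<^sup>(\<^sup>1\<^sup>)\<close> in the second claim and bounded in the third.
\<close>

section \<open>Bases and dimensions of subspaces\<close>

lemma vec_subspace_iff:
  "vec_subspace n U \<longleftrightarrow> U \<subseteq> carrier_vec n \<and> 0\<^sub>v n \<in> U \<and> (\<forall>x\<in>U. \<forall>y\<in>U. x + y \<in> U)
     \<and> (\<forall>c. \<forall>x\<in>U. c \<cdot>\<^sub>v x \<in> U)"
proof -
  interpret vec_space "TYPE(real)" n .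
  show ?thesis
    unfolding VectorSpace.subspace_def submodule_def
    using vec_vs vec_module by (auto simp: class_ring_simps module_vec_simps)
qed

lemma vec_subspace_dim_eq_card:
  assumes U: "vec_subspace n U" and S: "finite S" "S \<subseteq> U" "vec_span n S = U"
    and li: "\<not> LinearCombinations.module.lin_dep class_ring (module_vec TYPE(real) n) S"
  shows "vec_subspace_dim n U = card S"
proof -
  interpret vec_space "TYPE(real)" n .
  have sm: "submodule class_ring U V" using U by (simp add: VectorSpace.subspace_def)
  interpret W: vectorspace class_ring "vs U"
    by (rule subspace_is_vs[OF U])
  have "W.basis S"
    unfolding W.basis_def using span_li_not_depend[OF S(2) sm] S li by auto
  then show ?thesis using W.dim_basis S(1) by simp
qed

text \<open>
  Every subspace has a finite basis because linearly independent sets have at most \<open>n\<close> elements,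
  so a maximal one exists. Without this, the dimension of a subspace, which is defined through
  finite generating sets, could not be compared with anything.
\<close>
lemma vec_subspace_basis:
  assumes U: "vec_subspace n U"
  obtains S where "finite S" "S \<subseteq> U" "vec_span n S = U"
    "\<not> LinearCombinations.module.lin_dep class_ring (module_vec TYPE(real) n) S"
    "card S = vec_subspace_dim n U"
proof -
  interpret vec_space "TYPE(real)" n .
  have sm: "submodule class_ring U V" using U by (simp add: VectorSpace.subspace_def)
  have Uc: "U \<subseteq> carrier_vec n" using U by (simp add: vec_subspace_iff)
  interpret W: vectorspace class_ring "vs U"
    by (rule subspace_is_vs[OF U])
  have "\<exists>S. finite S \<and> maximal S (\<lambda>S. S \<subseteq> U \<and> \<not> lin_dep S)"
  proof (rule maximal_exists[where N = n and B = "{}"])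
    fix A assume A: "A \<subseteq> U \<and> \<not> lin_dep A"
    then show "finite A \<and> card A \<le> n"
      using li_le_dim[of A] Uc dim_is_n by auto
  next
    show "{} \<subseteq> U \<and> \<not> lin_dep {}" by (auto simp: lin_dep_def)
  qed
  then obtain S where S: "finite S" "maximal S (\<lambda>S. S \<subseteq> U \<and> \<not> lin_dep S)" by blast
  have SU: "S \<subseteq> U" "\<not> lin_dep S" using S(2) by (auto simp: maximal_def)
  have "maximal S (\<lambda>S. S \<subseteq> carrier (vs U) \<and> \<not> W.lin_dep S)"
    using S(2) span_li_not_depend(2)[OF _ sm] unfolding maximal_def by auto
  then have "W.gen_set S" by (rule W.max_li_is_gen)
  then have "span S = U" using span_li_not_depend(1)[OF SU(1) sm] by simp
  then show thesis
    using that[of S] S(1) SU vec_subspace_dim_eq_card[OF U S(1) SU(1)] by auto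
qed

lemma vec_subspace_eqI_dim:
  assumes U: "vec_subspace n U" and W: "vec_subspace n W" and sub: "U \<subseteq> W"
    and dims: "vec_subspace_dim n U = vec_subspace_dim n W"
  shows "U = W"
proof -
  interpret vec_space "TYPE(real)" n .
  have sm: "submodule class_ring W V" using W by (simp add: VectorSpace.subspace_def)
  interpret W: vectorspace class_ring "vs W"
    by (rule subspace_is_vs[OF W])
  obtain S where S: "finite S" "S \<subseteq> U" "span S = U" "\<not> lin_dep S" "card S = vec_subspace_dim n U"
    using vec_subspace_basis[OF U] .
  obtain T where T: "finite T" "T \<subseteq> W" "span T = W"
    using vec_subspace_basis[OF W] .
  have SW: "S \<subseteq> W" using S sub by auto
  have fd: "W.fin_dim"
    unfolding W.fin_dim_def using T span_li_not_depend(1)[OF T(2) sm] by auto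
  have "W.basis S"
    by (rule W.dim_li_is_basis) (use fd S SW dims span_li_not_depend(2)[OF SW sm] in auto)
  then have "span S = W"
    unfolding W.basis_def using span_li_not_depend(1)[OF SW sm] by simp
  then show ?thesis using S by simp
qed

lemma lin_indpt_orthogonal:
  assumes S: "finite S" "S \<subseteq> carrier_vec n"
    and orth: "\<And>x y. x \<in> S \<Longrightarrow> y \<in> S \<Longrightarrow> x \<noteq> y \<Longrightarrow> scalar_prod x y = 0"
    and nz: "\<And>x. x \<in> S \<Longrightarrow> scalar_prod x x \<noteq> 0"
  shows "\<not> LinearCombinations.module.lin_dep class_ring (module_vec TYPE(real) n) S"
proof
  interpret vec_space "TYPE(real)" n .
  assume "lin_dep S"
  then obtain A a v where A: "finite A" "A \<subseteq> S" "lincomb a A = 0\<^sub>v n" "v \<in> A" "a v \<noteq> 0"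
    unfolding lin_dep_def by auto
  have Ac: "A \<subseteq> carrier_vec n" and vc: "v \<in> carrier_vec n" using A S by auto
  have "lincomb a A \<bullet> v = (\<Sum>u\<in>A. (a u \<cdot>\<^sub>v u) \<bullet> v)"
    unfolding lincomb_def by (rule finsum_scalar_prod_sum) (use Ac vc in auto)
  also have "\<dots> = (\<Sum>u\<in>A. if u = v then a v * (v \<bullet> v) else 0)"
  proof (rule sum.cong[OF refl])
    fix u assume u: "u \<in> A"
    then have "u \<in> carrier_vec n" using Ac by auto
    then show "(a u \<cdot>\<^sub>v u) \<bullet> v = (if u = v then a v * (v \<bullet> v) else 0)"
      using u A orth[of u v] vc by auto
  qed
  also have "\<dots> = a v * (v \<bullet> v)" using A by simp
  finally show False using A vc nz[of v] by auto
qed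

lemma sum_single: "k < m \<Longrightarrow> (\<Sum>l<m. (if l = k then 1 else 0) * f l) = (f k :: real)" for k m :: nat
  by (subst sum.remove[of _ k]) auto

lemma vec_span_eq_range:
  fixes h :: "nat \<Rightarrow> nat \<Rightarrow> real"
  shows "vec_span n {Matrix.vec n (h k) | k. k < m} = range (\<lambda>c. Matrix.vec n (\<lambda>j. \<Sum>k<m. c k * h k j))"
proof -
  interpret vec_space "TYPE(real)" n .
  define G where "G = {Matrix.vec n (h k) | k. k < m}"
  define R where "R = (\<lambda>M c. Matrix.vec n (\<lambda>j. \<Sum>k<M. c k * h k j))"
  have Gc: "G \<subseteq> carrier_vec n" by (auto simp: G_def)
  have "vec_subspace n (range (R m))"
    unfolding vec_subspace_iff
  proof (intro conjI ballI allI)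
    show "range (R m) \<subseteq> carrier_vec n" by (auto simp: R_def)
    have "0\<^sub>v n = R m (\<lambda>_. 0)" by (auto simp: R_def)
    then show "0\<^sub>v n \<in> range (R m)" by blast
  next
    fix x y assume "x \<in> range (R m)" "y \<in> range (R m)"
    then obtain c e where xy: "x = R m c" "y = R m e" by auto
    have "x + y = R m (\<lambda>k. c k + e k)"
      unfolding xy R_def by (intro eq_vecI) (auto simp: sum.distrib algebra_simps)
    then show "x + y \<in> range (R m)" by blast
  next
    fix a x assume "x \<in> range (R m)"
    then obtain c where x: "x = R m c" by auto
    have "a \<cdot>\<^sub>v x = R m (\<lambda>k. a * c k)"
      unfolding x R_def by (intro eq_vecI) (auto simp: sum_distrib_left algebra_simps)
    then show "a \<cdot>\<^sub>v x \<in> range (R m)" by blast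
  qed
  then have sm: "submodule class_ring (range (R m)) V"
    by (simp add: VectorSpace.subspace_def)
  have "G \<subseteq> range (R m)"
  proof
    fix x assume "x \<in> G"
    then obtain k where k: "k < m" "x = Matrix.vec n (h k)"
      by (auto simp: G_def)
    have "x = R m (\<lambda>i. if i = k then 1 else 0)"
      unfolding k(2) R_def using k(1) by (intro eq_vecI) (auto simp: sum_single)
    then show "x \<in> range (R m)" by blast
  qed
  then have 1: "span G \<subseteq> range (R m)"
    by (rule span_is_subset[OF _ sm])
  have 2: "R M c \<in> span G" if "M \<le> m" for M c
    using that
  proof (induction M)
    case 0
    have "R 0 c = 0\<^sub>v n" by (auto simp: R_def)
    then show ?case using span_zero by simp
  next
    case (Suc M)
    have "Matrix.vec n (h M) \<in> G" unfolding G_def using Suc.prems Suc_le_lessD by blast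
    then have "Matrix.vec n (h M) \<in> span G"
      using in_own_span[OF Gc] by blast
    then have s: "c M \<cdot>\<^sub>v Matrix.vec n (h M) \<in> span G"
      by (rule smult_in_span[OF Gc])
    have "R (Suc M) c = R M c + c M \<cdot>\<^sub>v Matrix.vec n (h M)"
      unfolding R_def by (intro eq_vecI) auto
    then show ?case using span_add1[OF _ Suc.IH s] Gc Suc.prems by simp
  qed
  show ?thesis using 1 2[OF order_refl] unfolding G_def R_def by auto
qed

section \<open>Krylov subspaces of diagonal matrices\<close>

text \<open>
  \<open>p(diag d) b\<close> for the polynomial \<open>p\<close> with coefficients \<open>c 0, \<dots>, c (m - 1)\<close>. Indexing by coefficient
  sequences instead of polynomials gives a parameter space with a product topology, which the
  measurability argument below uses.
\<close>
definition power_comb :: "nat \<Rightarrow> nat \<Rightarrow> (nat \<Rightarrow> real) \<Rightarrow> (nat \<Rightarrow> real) \<Rightarrow> real Matrix.vec \<Rightarrow> real Matrix.vec" where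
  "power_comb n m d c b = Matrix.vec n (\<lambda>j. (\<Sum>k<m. c k * d j ^ k) * vec_index b j)"

lemma mat_diag_pow: "(mat_diag n d :: real mat) ^\<^sub>m k = mat_diag n (\<lambda>j. d j ^ k)"
proof (induction k)
  case 0
  show ?case by (simp add: mat_diag_def one_mat_def)
next
  case (Suc k)
  then show ?case by (simp add: mult.commute)
qed

lemma mat_diag_mult_vec:
  assumes "b \<in> carrier_vec n"
  shows "(mat_diag n d :: real mat) *\<^sub>v b = Matrix.vec n (\<lambda>j. d j * vec_index b j)"
proof (rule eq_vecI)
  fix i assume "i < dim_vec (Matrix.vec n (\<lambda>j. d j * vec_index b j))"
  then have i: "i < n" by simp
  have "(\<Sum>j<n. (if i = j then d j else 0) * vec_index b j) = d i * vec_index b i"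
    using i by (subst sum.remove[of _ i]) auto
  then show "vec_index (mat_diag n d *\<^sub>v b) i = vec_index (Matrix.vec n (\<lambda>j. d j * vec_index b j)) i"
    using i assms by (auto simp: mat_diag_def scalar_prod_def lessThan_atLeast0)
qed (auto simp: mat_diag_def)

lemma dim_row_mat_diag [simp]: "dim_row (mat_diag n d) = n"
  by (simp add: mat_diag_def)

lemma krylov_mat_diag:
  assumes b: "b \<in> carrier_vec n"
  shows "krylov (mat_diag n d) b m = range (\<lambda>c. power_comb n m d c b)"
proof -
  have "krylov (mat_diag n d) b m = vec_span n {Matrix.vec n (\<lambda>j. d j ^ k * vec_index b j) | k. k < m}"
    unfolding krylov_def using b by (simp add: mat_diag_pow mat_diag_mult_vec)
  then show ?thesis
    by (simp add: vec_span_eq_range power_comb_def sum_distrib_right mult.assoc)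
qed

lemma vec_subspace_krylov:
  assumes "b \<in> carrier_vec n"
  shows "vec_subspace n (krylov (mat_diag n d) b m)"
proof -
  interpret vec_space "TYPE(real)" n .
  show ?thesis unfolding krylov_def dim_row_mat_diag
    by (rule span_is_subspace) (use assms in \<open>auto simp: mat_diag_pow mat_diag_mult_vec\<close>)
qed

lemma mat_diag_sym: "mat_diag n d \<in> sym_mats n"
  by (auto simp: sym_mats_def mat_diag_def)

lemma eigval_mat_diag:
  fixes d :: "nat \<Rightarrow> real"
  assumes mono: "\<And>j k. j \<le> k \<Longrightarrow> k < n \<Longrightarrow> d k \<le> d j" and i: "1 \<le> i" "i \<le> n"
  shows "eigval (mat_diag n d) i = d (i - 1)"
proof -
  have "char_poly (mat_diag n d) = (\<Prod>a\<leftarrow>diag_mat (mat_diag n d). [:- a, 1:])"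
    by (rule char_poly_upper_triangular[of _ n]) (auto simp: mat_diag_def)
  also have "diag_mat (mat_diag n d) = map d [0..<n]"
    by (auto simp: diag_mat_def mat_diag_def)
  finally have cp: "char_poly (mat_diag n d) = (\<Prod>a\<leftarrow>map d [0..<n]. [:- a, 1:])" .
  have pr: "proots (\<Prod>a\<leftarrow>xs. [:- a, 1:]) = mset xs" for xs :: "real list"
  proof (induction xs)
    case (Cons a xs)
    have "(\<Prod>a\<leftarrow>xs. [:- a, 1:]) \<noteq> (0::real poly)" by (auto simp: prod_list_zero_iff)
    then show ?case using Cons by (simp add: proots_mult del: mult_pCons_left)
  qed simp
  have "sort (map d [0..<n]) = rev (map d [0..<n])"
  proof (rule properties_for_sort)
    show "sorted (rev (map d [0..<n]))"
      using mono by (auto simp: sorted_iff_nth_mono rev_nth)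
  qed simp
  then have "rev (sorted_list_of_multiset (proots (char_poly (mat_diag n d)))) = map d [0..<n]"
    unfolding cp pr sorted_list_of_multiset_mset by simp
  then show ?thesis unfolding eigval_def using i by simp
qed

lemma rayleigh_mat_diag:
  assumes "x \<in> carrier_vec n"
  shows "rayleigh (mat_diag n d) x = (\<Sum>j<n. d j * (vec_index x j)\<^sup>2) / (\<Sum>j<n. (vec_index x j)\<^sup>2)"
  using assms unfolding rayleigh_def
  by (simp add: mat_diag_mult_vec scalar_prod_def lessThan_atLeast0 power2_eq_square algebra_simps)

lemma scalar_prod_self: "x \<in> carrier_vec n \<Longrightarrow> scalar_prod x x = (\<Sum>j<n. (vec_index x j :: real)\<^sup>2)"
  by (simp add: scalar_prod_def lessThan_atLeast0 power2_eq_square)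

lemma scalar_prod_self_eq_0:
  "x \<in> carrier_vec n \<Longrightarrow> (\<Sum>j<n. (vec_index x j :: real)\<^sup>2) = 0 \<longleftrightarrow> x = 0\<^sub>v n"
  by (auto simp: sum_nonneg_eq_0_iff)

section \<open>The largest Ritz value as a maximum of Rayleigh quotients\<close>

lemma vec_subspace_line:
  assumes x: "x \<in> carrier_vec n" "x \<noteq> 0\<^sub>v n"
  shows "vec_subspace n (range (\<lambda>c. c \<cdot>\<^sub>v x))" "vec_subspace_dim n (range (\<lambda>c. c \<cdot>\<^sub>v x)) = 1"
proof -
  interpret vec_space "TYPE(real)" n .
  show sub: "vec_subspace n (range (\<lambda>c. c \<cdot>\<^sub>v x))"
    unfolding vec_subspace_iff
  proof (intro conjI)
    show "0\<^sub>v n \<in> range (\<lambda>c. c \<cdot>\<^sub>v x)" using x by (auto intro!: image_eqI[of _ _ 0])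
    show "\<forall>u\<in>range (\<lambda>c. c \<cdot>\<^sub>v x). \<forall>w\<in>range (\<lambda>c. c \<cdot>\<^sub>v x). u + w \<in> range (\<lambda>c. c \<cdot>\<^sub>v x)"
      by (auto simp: add_smult_distrib_vec[symmetric])
    show "\<forall>a. \<forall>u\<in>range (\<lambda>c. c \<cdot>\<^sub>v x). a \<cdot>\<^sub>v u \<in> range (\<lambda>c. c \<cdot>\<^sub>v x)"
      by (auto simp: smult_smult_assoc)
  qed (use x in auto)
  have li: "\<not> lin_dep {x}"
    by (rule lin_indpt_orthogonal)
      (use x in \<open>auto simp: scalar_prod_self scalar_prod_self_eq_0\<close>)
  have "span {x} = range (\<lambda>c. c \<cdot>\<^sub>v x)"
  proof -
    have "span {x} = {lincomb a {x} | a. True}"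
      using finite_span[of "{x}"] x by auto
    also have "\<dots> = range (\<lambda>c. c \<cdot>\<^sub>v x)"
    proof -
      have "lincomb a {x} = a x \<cdot>\<^sub>v x" for a unfolding lincomb_def using x by auto
      then show ?thesis by (auto intro!: exI[of _ "\<lambda>_. _"])
    qed
    finally show ?thesis .
  qed
  moreover have "x \<in> range (\<lambda>c. c \<cdot>\<^sub>v x)" by (auto intro!: image_eqI[of _ _ 1])
  ultimately show "vec_subspace_dim n (range (\<lambda>c. c \<cdot>\<^sub>v x)) = 1"
    using vec_subspace_dim_eq_card[OF sub _ _ _ li] by auto
qed

lemma vec_subspace_dim_1E:
  assumes U: "vec_subspace n U" and dim: "vec_subspace_dim n U = 1"
  obtains x where "x \<in> U" "x \<noteq> 0\<^sub>v n" "U = range (\<lambda>c. c \<cdot>\<^sub>v x)"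
proof -
  interpret vec_space "TYPE(real)" n .
  have Uc: "U \<subseteq> carrier_vec n" and sm: "\<And>c x. x \<in> U \<Longrightarrow> c \<cdot>\<^sub>v x \<in> U"
    using U by (auto simp: vec_subspace_iff)
  obtain S where S: "finite S" "S \<subseteq> U" "\<not> lin_dep S" "card S = 1"
    using vec_subspace_basis[OF U] dim by metis
  obtain x where x: "S = {x}" using S(4) by (auto simp: card_1_singleton_iff)
  have xU: "x \<in> U" and x0: "x \<noteq> 0\<^sub>v n"
    using S x vs_zero_lin_dep[of S] Uc by auto
  have xc: "x \<in> carrier_vec n" using xU Uc by auto
  have "range (\<lambda>c. c \<cdot>\<^sub>v x) = U"
    by (rule vec_subspace_eqI_dim[OF vec_subspace_line(1)[OF xc x0] U])
      (use vec_subspace_line(2)[OF xc x0] dim xU sm in auto)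
  then show thesis using that xU x0 by blast
qed

lemma rayleigh_smult:
  assumes "c \<noteq> 0" "x \<in> carrier_vec n" "A \<in> carrier_mat n n"
  shows "rayleigh A (c \<cdot>\<^sub>v x) = rayleigh A x"
  using assms unfolding rayleigh_def
  by (simp add: mult_mat_vec[of A n n x c] field_simps)

text \<open>
  One-dimensional subspaces are lines, and the Rayleigh quotient is constant on a line without the
  origin.
\<close>
lemma ritz_1:
  assumes A: "A \<in> carrier_mat n n" and K: "vec_subspace n (krylov A b m)"
  shows "ritz A b m 1 = (SUP x \<in> krylov A b m - {0\<^sub>v n}. rayleigh A x)"
proof -
  have dr: "dim_row A = n" using A by simp
  let ?K = "krylov A b m"
  have Kc: "?K \<subseteq> carrier_vec n" using K by (simp add: vec_subspace_iff)
  have inf_line: "(INF y \<in> range (\<lambda>c. c \<cdot>\<^sub>v x) - {0\<^sub>v n}. rayleigh A y) = rayleigh A x"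
    if x: "x \<in> carrier_vec n" "x \<noteq> 0\<^sub>v n" for x
  proof -
    have "rayleigh A y = rayleigh A x" if y: "y \<in> range (\<lambda>c. c \<cdot>\<^sub>v x) - {0\<^sub>v n}" for y
    proof -
      obtain c where c: "y = c \<cdot>\<^sub>v x" using y by auto
      have "c \<noteq> 0" using y c x by auto
      then show ?thesis using rayleigh_smult[OF _ x(1) A] c by simp
    qed
    moreover have "x \<in> range (\<lambda>c. c \<cdot>\<^sub>v x) - {0\<^sub>v n}" using x by (auto intro!: image_eqI[of _ _ 1])
    ultimately have "rayleigh A ` (range (\<lambda>c. c \<cdot>\<^sub>v x) - {0\<^sub>v n}) = {rayleigh A x}" by blast
    then show ?thesis by simp
  qed
  have "(\<lambda>U. INF y \<in> U - {0\<^sub>v n}. rayleigh A y) `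
      {U. vec_subspace n U \<and> U \<subseteq> ?K \<and> vec_subspace_dim n U = 1} = rayleigh A ` (?K - {0\<^sub>v n})"
    (is "?L = ?R")
  proof (intro equalityI subsetI)
    fix z assume "z \<in> ?L"
    then obtain U where U: "vec_subspace n U" "U \<subseteq> ?K" "vec_subspace_dim n U = 1"
      "z = (INF y \<in> U - {0\<^sub>v n}. rayleigh A y)" by auto
    obtain x where x: "x \<in> U" "x \<noteq> 0\<^sub>v n" "U = range (\<lambda>c. c \<cdot>\<^sub>v x)"
      using vec_subspace_dim_1E[OF U(1,3)] .
    have "z = rayleigh A x" using inf_line[of x] x U Kc by auto
    then show "z \<in> ?R" using x U by auto
  next
    fix z assume "z \<in> ?R"
    then obtain x where x: "x \<in> ?K" "x \<noteq> 0\<^sub>v n" "z = rayleigh A x" by auto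
    have xc: "x \<in> carrier_vec n" using x Kc by auto
    have "range (\<lambda>c. c \<cdot>\<^sub>v x) \<subseteq> ?K" using K x(1) by (auto simp: vec_subspace_iff)
    then have "range (\<lambda>c. c \<cdot>\<^sub>v x) \<in> {U. vec_subspace n U \<and> U \<subseteq> ?K \<and> vec_subspace_dim n U = 1}"
      using vec_subspace_line[OF xc x(2)] by simp
    then show "z \<in> ?L" using inf_line[OF xc x(2)] x(3) by (intro image_eqI) auto
  qed
  then show ?thesis unfolding ritz_def dr by simp
qed

text \<open>
  For a diagonal matrix a bound on the largest Ritz value says that a quadratic form in the
  coefficients of the polynomial is positive semidefinite. Its coefficients depend on the start
  vector only through the squares of the entries.
\<close>
lemma ritz_1_le_iff:
  assumes b: "b \<in> carrier_vec n" "b \<noteq> 0\<^sub>v n" and m: "m \<ge> 1"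
  shows "ritz_defined (mat_diag n d) b m 1"
    "ritz (mat_diag n d) b m 1 \<le> s \<longleftrightarrow>
       (\<forall>c. (\<Sum>j<n. (s - d j) * ((\<Sum>k<m. c k * d j ^ k) * vec_index b j)\<^sup>2) \<ge> 0)"
proof -
  let ?A = "mat_diag n d" and ?K = "krylov (mat_diag n d) b m"
  have K: "vec_subspace n ?K" by (rule vec_subspace_krylov[OF b(1)])
  have Kc: "?K \<subseteq> carrier_vec n" using K by (simp add: vec_subspace_iff)
  have bK: "b \<in> ?K"
  proof -
    have "b = power_comb n m d (\<lambda>k. if k = 0 then 1 else 0) b"
      unfolding power_comb_def using b m
      by (intro eq_vecI) (auto simp: sum_single)
    then show ?thesis unfolding krylov_mat_diag[OF b(1)] by blast
  qed
  show "ritz_defined ?A b m 1"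
  proof (rule ccontr)
    assume "\<not> ritz_defined ?A b m 1"
    then have "vec_subspace_dim n ?K = 0" by (simp add: ritz_defined_def)
    then obtain S where S: "finite S" "vec_span n S = ?K" "card S = 0"
      using vec_subspace_basis[OF K] by metis
    interpret vec_space "TYPE(real)" n .
    have "?K = {0\<^sub>v n}" using S span_empty by auto
    then show False using bK b by auto
  qed
  have bound: "rayleigh ?A x \<le> (\<Sum>j<n. \<bar>d j\<bar>)" if x: "x \<in> ?K - {0\<^sub>v n}" for x
  proof -
    have xc: "x \<in> carrier_vec n" using x Kc by auto
    have pos: "(\<Sum>j<n. (vec_index x j)\<^sup>2) > 0"
      using scalar_prod_self_eq_0[OF xc] x by (metis DiffD2 insertCI less_eq_real_def sum_nonneg zero_le_power2)
    have "(\<Sum>j<n. d j * (vec_index x j)\<^sup>2) \<le> (\<Sum>j<n. (\<Sum>j<n. \<bar>d j\<bar>) * (vec_index x j)\<^sup>2)"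
    proof (intro sum_mono mult_right_mono)
      fix j assume "j \<in> {..<n}"
      then have "\<bar>d j\<bar> \<le> (\<Sum>j<n. \<bar>d j\<bar>)" by (intro member_le_sum) auto
      then show "d j \<le> (\<Sum>j<n. \<bar>d j\<bar>)" by linarith
    qed auto
    then show ?thesis
      using pos by (simp add: rayleigh_mat_diag[OF xc] divide_le_eq sum_distrib_left)
  qed
  have "ritz ?A b m 1 \<le> s \<longleftrightarrow> (\<forall>x\<in>?K - {0\<^sub>v n}. rayleigh ?A x \<le> s)"
    unfolding ritz_1[OF mat_diag_dim K]
    by (rule cSUP_le_iff) (use bK b bound in \<open>auto intro!: bdd_aboveI[of _ "\<Sum>j<n. \<bar>d j\<bar>"]\<close>)
  also have "\<dots> \<longleftrightarrow> (\<forall>x\<in>?K. (\<Sum>j<n. (s - d j) * (vec_index x j)\<^sup>2) \<ge> 0)"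
  proof -
    have "(x \<noteq> 0\<^sub>v n \<longrightarrow> rayleigh ?A x \<le> s) \<longleftrightarrow> (\<Sum>j<n. (s - d j) * (vec_index x j)\<^sup>2) \<ge> 0"
      if x: "x \<in> ?K" for x
    proof (cases "x = 0\<^sub>v n")
      case True
      then show ?thesis by simp
    next
      case False
      have xc: "x \<in> carrier_vec n" using x Kc by auto
      have pos: "(\<Sum>j<n. (vec_index x j)\<^sup>2) > 0"
        using scalar_prod_self_eq_0[OF xc] False by (metis less_eq_real_def sum_nonneg zero_le_power2)
      show ?thesis
        using pos False by (simp add: rayleigh_mat_diag[OF xc] divide_le_eq sum_distrib_left
          left_diff_distrib sum_subtractf)
    qed
    then show ?thesis by blast
  qed
  also have "\<dots> \<longleftrightarrow> (\<forall>c. (\<Sum>j<n. (s - d j) * ((\<Sum>k<m. c k * d j ^ k) * vec_index b j)\<^sup>2) \<ge> 0)"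
    unfolding krylov_mat_diag[OF b(1)] by (simp add: power_comb_def)
  finally show "ritz ?A b m 1 \<le> s \<longleftrightarrow>
       (\<forall>c. (\<Sum>j<n. (s - d j) * ((\<Sum>k<m. c k * d j ^ k) * vec_index b j)\<^sup>2) \<ge> 0)" .
qed

section \<open>Lagrange interpolation\<close>

definition lagrange_basis :: "nat \<Rightarrow> (nat \<Rightarrow> real) \<Rightarrow> nat \<Rightarrow> real poly" where
  "lagrange_basis m x k =
     Polynomial.smult (inverse (\<Prod>l\<in>{..<m} - {k}. x k - x l)) (\<Prod>l\<in>{..<m} - {k}. [:- x l, 1:])"

lemma degree_lagrange_basis:
  assumes "k < m"
  shows "degree (lagrange_basis m x k) < m"
proof -
  have "degree (\<Prod>l\<in>{..<m} - {k}. [:- x l, 1:]) \<le> m - 1"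
    using degree_prod_sum_le[of "{..<m} - {k}" "\<lambda>l. [:- x l, 1:]"] assms by (simp add: o_def)
  then show ?thesis unfolding lagrange_basis_def
    using assms degree_smult_le[of "inverse (\<Prod>l\<in>{..<m} - {k}. x k - x l)" "\<Prod>l\<in>{..<m} - {k}. [:- x l, 1:]"]
    by linarith
qed

lemma poly_lagrange_basis:
  "poly (lagrange_basis m x k) y = (\<Prod>l\<in>{..<m} - {k}. y - x l) / (\<Prod>l\<in>{..<m} - {k}. x k - x l)"
  by (simp add: lagrange_basis_def poly_prod divide_inverse mult.commute)

lemma poly_lagrange_basis_node:
  assumes "inj_on x {..<m}" "k < m" "l < m"
  shows "poly (lagrange_basis m x k) (x l) = (if l = k then 1 else 0)"
proof (cases "l = k")
  case True
  have "(\<Prod>l\<in>{..<m} - {k}. x k - x l) \<noteq> 0"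
    using assms by (auto simp: inj_on_def)
  then show ?thesis using True by (simp add: poly_lagrange_basis)
next
  case False
  have "(\<Prod>j\<in>{..<m} - {k}. x l - x j) = 0"
    using assms False by auto
  then show ?thesis using False by (simp add: poly_lagrange_basis)
qed

definition lagrange_poly :: "nat \<Rightarrow> (nat \<Rightarrow> real) \<Rightarrow> (nat \<Rightarrow> real) \<Rightarrow> real poly" where
  "lagrange_poly m x f = (\<Sum>k<m. Polynomial.smult (f k) (lagrange_basis m x k))"

lemma degree_lagrange_poly:
  assumes "m \<ge> 1"
  shows "degree (lagrange_poly m x f) < m"
  unfolding lagrange_poly_def
  by (rule degree_sum_less)
    (use assms degree_lagrange_basis degree_smult_le in \<open>auto intro: le_less_trans\<close>)

lemma poly_lagrange_poly_node:
  assumes "inj_on x {..<m}" "l < m"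
  shows "poly (lagrange_poly m x f) (x l) = f l"
proof -
  have "poly (lagrange_poly m x f) (x l) = (\<Sum>k<m. f k * (if l = k then 1 else 0))"
    unfolding lagrange_poly_def poly_sum
    by (rule sum.cong) (use assms poly_lagrange_basis_node in auto)
  then show ?thesis using assms by (simp add: if_distrib cong: if_cong)
qed

lemma lagrange_interpolation:
  assumes "inj_on x {..<m}" "degree p < m"
  shows "poly p y = (\<Sum>k<m. poly p (x k) * poly (lagrange_basis m x k) y)"
proof -
  have "p = lagrange_poly m x (\<lambda>k. poly p (x k))"
  proof (rule poly_eqI_degree[of "x ` {..<m}"])
    fix z assume "z \<in> x ` {..<m}"
    then show "poly p z = poly (lagrange_poly m x (\<lambda>k. poly p (x k))) z"
      using poly_lagrange_poly_node[OF assms(1)] by auto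
  next
    show "degree p < card (x ` {..<m})" using assms by (simp add: card_image)
    show "degree (lagrange_poly m x (\<lambda>k. poly p (x k))) < card (x ` {..<m})"
      using assms by (simp add: card_image degree_lagrange_poly)
  qed
  then have "poly p y = poly (lagrange_poly m x (\<lambda>k. poly p (x k))) y" by simp
  then show ?thesis by (simp add: lagrange_poly_def poly_sum)
qed

lemma poly_eq_sum_lessThan:
  fixes p :: "real poly"
  assumes "degree p < m"
  shows "poly p z = (\<Sum>k<m. coeff p k * z ^ k)"
  unfolding poly_altdef
  by (rule sum.mono_neutral_left) (use assms in \<open>auto simp: coeff_eq_0\<close>)

section \<open>Krylov subspaces that are sums of eigenspace components\<close>

text \<open>
  If the matrix has at most \<open>i \<le> m\<close> different eigenvalues, interpolation at them produces every
  eigenspace component of the start vector as a polynomial in the matrix applied to it.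
\<close>
lemma krylov_groups:
  assumes b: "b \<in> carrier_vec n" and g: "\<And>j. j < n \<Longrightarrow> g j < i" and i: "1 \<le> i" "i \<le> m"
  shows "krylov (mat_diag n (\<lambda>j. real (g j))) b m =
           vec_span n {Matrix.vec n (\<lambda>j. if g j = k then vec_index b j else 0) | k. k < i}"
    (is "?K = ?S")
proof -
  have K: "?K = range (\<lambda>f. Matrix.vec n (\<lambda>j. f (g j) * vec_index b j))" (is "_ = ?F")
  proof (intro equalityI subsetI)
    fix z assume "z \<in> ?K"
    then obtain c where "z = power_comb n m (\<lambda>j. real (g j)) c b"
      unfolding krylov_mat_diag[OF b] by auto
    then show "z \<in> ?F"
      by (intro image_eqI[of _ _ "\<lambda>l. \<Sum>k<m. c k * real l ^ k"]) (auto simp: power_comb_def)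
  next
    fix z assume "z \<in> ?F"
    then obtain f where z: "z = Matrix.vec n (\<lambda>j. f (g j) * vec_index b j)" by auto
    let ?p = "lagrange_poly i real f"
    have deg: "degree ?p < m" using degree_lagrange_poly[OF i(1)] i(2) by (rule less_le_trans)
    have "z = power_comb n m (\<lambda>j. real (g j)) (coeff ?p) b"
      unfolding z power_comb_def poly_eq_sum_lessThan[OF deg, symmetric]
      using g by (intro eq_vecI) (simp_all add: poly_lagrange_poly_node inj_on_def)
    then show "z \<in> ?K" unfolding krylov_mat_diag[OF b] by blast
  qed
  have "?S = range (\<lambda>c. Matrix.vec n (\<lambda>j. \<Sum>k<i. c k * (if g j = k then vec_index b j else 0)))"
    by (rule vec_span_eq_range)
  also have "\<dots> = ?F"
  proof (rule image_cong[OF refl])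
    fix c
    show "Matrix.vec n (\<lambda>j. \<Sum>k<i. c k * (if g j = k then vec_index b j else 0)) =
          Matrix.vec n (\<lambda>j. c (g j) * vec_index b j)"
    proof (rule eq_vecI)
      fix j assume "j < dim_vec (Matrix.vec n (\<lambda>j. c (g j) * vec_index b j))"
      then have j: "j < n" by simp
      have "(\<Sum>k<i. c k * (if g j = k then vec_index b j else 0)) = c (g j) * vec_index b j"
        using g[OF j] by (subst sum.remove[of _ "g j"]) auto
      then show "vec_index (Matrix.vec n (\<lambda>j. \<Sum>k<i. c k * (if g j = k then vec_index b j else 0))) j =
          vec_index (Matrix.vec n (\<lambda>j. c (g j) * vec_index b j)) j" using j by simp
    qed simp
  qed
  finally show ?thesis using K by simp
qed

text \<open>
  The eigenspace components of \<open>b\<close> are orthogonal, so the Krylov subspace has dimension \<open>i\<close> exactly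
  if none of the \<open>i\<close> components vanishes. In that case the only subspace of dimension \<open>i\<close> is the Krylov
  subspace itself, and it contains the component for the eigenvalue \<open>0\<close>.
\<close>
lemma ritz_groups:
  assumes b: "b \<in> carrier_vec n" and g: "\<And>j. j < n \<Longrightarrow> g j < i" and i: "1 \<le> i" "i \<le> m"
  shows "ritz_defined (mat_diag n (\<lambda>j. real (g j))) b m i \<longleftrightarrow>
           (\<forall>k<i. \<exists>j<n. g j = k \<and> vec_index b j \<noteq> 0)"
    and "ritz_defined (mat_diag n (\<lambda>j. real (g j))) b m i \<Longrightarrow>
           ritz (mat_diag n (\<lambda>j. real (g j))) b m i \<le> 0"
proof -
  interpret vec_space "TYPE(real)" n .
  let ?A = "mat_diag n (\<lambda>j. real (g j))"
  let ?K = "krylov ?A b m"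
  define e where "e = (\<lambda>k. Matrix.vec n (\<lambda>j. if g j = k then vec_index b j else 0))"
  define J where "J = {k. k < i \<and> e k \<noteq> 0\<^sub>v n}"
  have ec: "e k \<in> carrier_vec n" for k by (simp add: e_def)
  have e0: "e k \<noteq> 0\<^sub>v n \<longleftrightarrow> (\<exists>j<n. g j = k \<and> vec_index b j \<noteq> 0)" for k
    by (auto simp: e_def vec_eq_iff)
  have K: "vec_subspace n ?K" by (rule vec_subspace_krylov[OF b])
  have Kspan: "?K = span (e ` {..<i})"
  proof -
    have "{Matrix.vec n (\<lambda>j. if g j = k then vec_index b j else 0) | k. k < i} = e ` {..<i}"
      by (auto simp: e_def)
    then show ?thesis using krylov_groups[OF assms] by simp
  qed
  also have "span (e ` {..<i}) = span (e ` J)"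
  proof (cases "\<exists>k<i. e k = 0\<^sub>v n")
    case True
    then obtain l where "l < i" "e l = 0\<^sub>v n" by blast
    then have "0\<^sub>v n \<in> e ` {..<i}" by (intro image_eqI[of _ _ l]) auto
    then have "e ` {..<i} = e ` J \<union> {0\<^sub>v n}" by (auto simp: J_def)
    moreover have "span (e ` J) = span (e ` J \<union> {0\<^sub>v n})"
      by (rule already_in_span) (use ec span_zero in auto)
    ultimately show ?thesis by simp
  next
    case False
    then have "J = {..<i}" by (auto simp: J_def)
    then show ?thesis by simp
  qed
  finally have KJ: "?K = span (e ` J)" .
  have orth: "e k \<bullet> e l = 0" if "k \<noteq> l" for k l
    unfolding scalar_prod_def e_def using that by (auto intro!: sum.neutral)
  have orth': "e k \<bullet> e l = 0" if "e k \<noteq> e l" for k l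
    using orth[of k l] that by auto
  have self: "e k \<bullet> e k \<noteq> 0" if "k \<in> J" for k
    using that ec[of k] by (simp add: J_def scalar_prod_self scalar_prod_self_eq_0)
  have inj: "inj_on e J"
  proof (rule inj_onI)
    fix k l assume "k \<in> J" "l \<in> J" "e k = e l"
    then show "k = l" using orth[of k l] self[of k] by auto
  qed
  have "vec_subspace_dim n ?K = card (e ` J)"
  proof (rule vec_subspace_dim_eq_card[OF K])
    show "finite (e ` J)" by (simp add: J_def)
    show "e ` J \<subseteq> ?K" unfolding KJ by (rule in_own_span) (use ec in auto)
    show "span (e ` J) = ?K" by (simp add: KJ)
    show "\<not> lin_dep (e ` J)"
      by (rule lin_indpt_orthogonal) (use ec orth' self in \<open>auto simp: J_def\<close>)
  qed
  then have dim: "vec_subspace_dim n ?K = card J" using inj by (simp add: card_image)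
  have Ji: "J \<subseteq> {..<i}" by (auto simp: J_def)
  have def_iff: "ritz_defined ?A b m i \<longleftrightarrow> J = {..<i}"
  proof
    assume "ritz_defined ?A b m i"
    then have "i \<le> card J" by (simp add: ritz_defined_def dim)
    then show "J = {..<i}" using Ji by (intro card_subset_eq) (auto intro!: antisym card_mono[of "{..<i}" J, simplified])
  qed (simp add: ritz_defined_def dim)
  show "ritz_defined ?A b m i \<longleftrightarrow> (\<forall>k<i. \<exists>j<n. g j = k \<and> vec_index b j \<noteq> 0)"
    unfolding def_iff e0[symmetric] using Ji by (auto simp: J_def)
  assume "ritz_defined ?A b m i"
  then have Jall: "J = {..<i}" by (simp add: def_iff)
  have "{U. vec_subspace n U \<and> U \<subseteq> ?K \<and> vec_subspace_dim n U = i} = {?K}"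
    using vec_subspace_eqI_dim[OF _ K] K dim Jall by auto
  then have ritz: "ritz ?A b m i = (INF x \<in> ?K - {0\<^sub>v n}. rayleigh ?A x)"
    unfolding ritz_def by simp
  have "(INF x \<in> ?K - {0\<^sub>v n}. rayleigh ?A x) \<le> rayleigh ?A (e 0)"
  proof (rule cINF_lower)
    have "0 \<le> rayleigh ?A x" if "x \<in> ?K" for x
    proof -
      have "x \<in> carrier_vec n" using that K by (auto simp: vec_subspace_iff)
      then show ?thesis by (auto simp: rayleigh_mat_diag intro!: divide_nonneg_nonneg sum_nonneg)
    qed
    then show "bdd_below (rayleigh ?A ` (?K - {0\<^sub>v n}))" by (auto intro!: bdd_belowI[of _ 0])
    have "e ` J \<subseteq> ?K" unfolding KJ by (rule in_own_span) (use ec in auto)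
    moreover have "0 \<in> J" using Jall i by simp
    ultimately show "e 0 \<in> ?K - {0\<^sub>v n}" by (auto simp: J_def)
  qed
  also have "rayleigh ?A (e 0) = 0"
    unfolding rayleigh_mat_diag[OF ec] by (simp add: e_def)
  finally show "ritz ?A b m i \<le> 0" using ritz by simp
qed

section \<open>Extrapolation from Chebyshev nodes\<close>

text \<open>
  The Chebyshev polynomials of the first kind.
\<close>
fun cheb :: "nat \<Rightarrow> real poly" where
  "cheb 0 = 1"
| "cheb (Suc 0) = [:0, 1:]"
| "cheb (Suc (Suc n)) = [:0, 2:] * cheb (Suc n) - cheb n"

lemma degree_cheb: "degree (cheb n) \<le> n"
proof (induction n rule: cheb.induct)
  case (3 n)
  have "degree ([:0, 2:] * cheb (Suc n)) \<le> Suc (Suc n)"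
    using degree_mult_le[of "[:0, 2:]" "cheb (Suc n)"] 3 by simp
  then show ?case using 3 by (simp add: degree_diff_le del: mult_pCons_left)
qed auto

lemma poly_cheb_cos: "poly (cheb n) (cos \<theta>) = cos (real n * \<theta>)"
proof (induction n rule: cheb.induct)
  case (3 n)
  have "cos (real (Suc (Suc n)) * \<theta>) = cos (real (Suc n) * \<theta> + \<theta>)"
    "cos (real n * \<theta>) = cos (real (Suc n) * \<theta> - \<theta>)" by (simp_all add: algebra_simps)
  then show ?case using 3 by (simp add: cos_add cos_diff)
qed auto

text \<open>
  Outside \<open>[-1, 1]\<close> the Chebyshev polynomials are computed from the preimage under the Joukowski
  map, which turns their growth into a power.
\<close>
lemma poly_cheb_joukowski:
  assumes "z \<noteq> 0"
  shows "poly (cheb n) ((z + 1 / z) / 2) = (z ^ n + 1 / z ^ n) / 2"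
proof (induction n rule: cheb.induct)
  case (3 n)
  have "poly (cheb (Suc (Suc n))) ((z + 1 / z) / 2) =
      (z + 1 / z) * poly (cheb (Suc n)) ((z + 1 / z) / 2) - poly (cheb n) ((z + 1 / z) / 2)"
    by simp
  also have "\<dots> = (z + 1 / z) * ((z ^ Suc n + 1 / z ^ Suc n) / 2) - (z ^ n + 1 / z ^ n) / 2"
    unfolding 3 ..
  also have "\<dots> = (z ^ Suc (Suc n) + 1 / z ^ Suc (Suc n)) / 2"
    using assms by (simp add: field_simps)
  finally show ?case .
qed auto

definition cheb_angle :: "nat \<Rightarrow> nat \<Rightarrow> real" where
  "cheb_angle m k = (2 * real k + 1) * pi / (2 * real m)"

definition cheb_root :: "nat \<Rightarrow> nat \<Rightarrow> real" where
  "cheb_root m k = cos (cheb_angle m k)"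

lemma cheb_angle_bounds:
  assumes "k < m"
  shows "pi / (2 * real m) \<le> cheb_angle m k" "cheb_angle m k < pi"
proof -
  have m: "real m > 0" "2 * real k + 1 < 2 * real m" using assms by auto
  show "pi / (2 * real m) \<le> cheb_angle m k"
    unfolding cheb_angle_def using m by (intro divide_right_mono) auto
  show "cheb_angle m k < pi"
  proof -
    have "(2 * real k + 1) * pi < 2 * real m * pi"
      using m by (intro mult_strict_right_mono) auto
    then show ?thesis using m by (simp add: cheb_angle_def divide_less_eq mult.commute)
  qed
qed

lemma cheb_root_less:
  assumes "k < l" "l < m"
  shows "cheb_root m l < cheb_root m k"
  unfolding cheb_root_def
proof (rule cos_monotone_0_pi)
  show "0 \<le> cheb_angle m k" by (simp add: cheb_angle_def)
  show "cheb_angle m k < cheb_angle m l"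
    unfolding cheb_angle_def using assms by (intro divide_strict_right_mono) auto
  show "cheb_angle m l \<le> pi" using cheb_angle_bounds[OF assms(2)] by simp
qed

lemma inj_cheb_root: "inj_on (cheb_root m) {..<m}"
  by (rule inj_onI) (metis cheb_root_less lessThan_iff linorder_neqE_nat order_less_irrefl)

lemma m_times_cheb_angle: "m \<ge> 1 \<Longrightarrow> real m * cheb_angle m k = real k * pi + pi / 2"
  by (simp add: cheb_angle_def field_simps)

lemma poly_cheb_root: "k < m \<Longrightarrow> poly (cheb m) (cheb_root m k) = 0"
  by (simp add: cheb_root_def poly_cheb_cos m_times_cheb_angle cos_add)

lemma cheb_factorization:
  assumes "m \<ge> 1"
  obtains c where "c \<noteq> 0" "cheb m = Polynomial.smult c (\<Prod>l<m. [:- cheb_root m l, 1:])"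
proof -
  let ?P = "\<Prod>l<m. [:- cheb_root m l, 1:]" and ?c = "coeff (cheb m) m"
  have monic: "lead_coeff ?P = 1" and deg: "degree ?P = m"
    by (simp add: lead_coeff_prod, simp add: degree_prod_eq_sum_degree)
  have "cheb m - Polynomial.smult ?c ?P = 0"
  proof (rule ccontr)
    let ?q = "cheb m - Polynomial.smult ?c ?P"
    assume q: "?q \<noteq> 0"
    have "degree ?q \<le> m"
      by (rule degree_diff_le) (use degree_cheb deg degree_smult_le[of ?c ?P] in auto)
    moreover have "coeff ?q m = 0" using monic deg by simp
    ultimately have dq: "degree ?q < m"
      using q by (metis le_neq_implies_less leading_coeff_0_iff)
    have "cheb_root m ` {..<m} \<subseteq> {z. poly ?q z = 0}"
      by (auto simp: poly_cheb_root poly_prod)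
    then have "card (cheb_root m ` {..<m}) \<le> card {z. poly ?q z = 0}"
      by (intro card_mono poly_roots_finite[OF q])
    also have "\<dots> \<le> degree ?q" by (rule card_poly_roots_bound[OF q])
    finally show False using dq by (simp add: card_image inj_cheb_root)
  qed
  then have fact: "cheb m = Polynomial.smult ?c ?P" by simp
  have "poly (cheb m) (cos 0) = 1" unfolding poly_cheb_cos by simp
  then have "?c \<noteq> 0" using fact by force
  then show thesis using that fact by blast
qed

text \<open>
  Differentiate \<open>T\<^sub>m (cos \<theta>) = cos (m \<theta>)\<close>; at a root the sine of \<open>m \<theta>\<close> is \<open>1\<close> or \<open>-1\<close>.
\<close>
lemma pderiv_cheb_root:
  assumes "k < m"
  shows "\<bar>poly (pderiv (cheb m)) (cheb_root m k)\<bar> * sin (cheb_angle m k) = real m"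
proof -
  let ?t = "cheb_angle m k"
  have 1: "((\<lambda>t. poly (cheb m) (cos t)) has_real_derivative poly (pderiv (cheb m)) (cos ?t) * (- sin ?t)) (at ?t)"
    by (rule DERIV_chain2[OF poly_DERIV DERIV_cos])
  have 2: "((\<lambda>t. cos (real m * t)) has_real_derivative - sin (real m * ?t) * real m) (at ?t)"
    by (auto intro!: derivative_eq_intros)
  have "poly (pderiv (cheb m)) (cos ?t) * (- sin ?t) = - sin (real m * ?t) * real m"
    using DERIV_unique[OF 1] 2 unfolding poly_cheb_cos by blast
  moreover have "\<bar>sin (real m * ?t)\<bar> = 1"
    using assms by (simp add: m_times_cheb_angle sin_add)
  moreover have "sin ?t > 0"
  proof (rule sin_gt_zero)
    have "0 < pi / (2 * real m)" using assms by simp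
    then show "0 < ?t" using cheb_angle_bounds(1)[OF assms] by linarith
  qed (use cheb_angle_bounds[OF assms] in simp)
  ultimately have s: "sin ?t > 0" and
    e: "\<bar>poly (pderiv (cheb m)) (cos ?t) * (- sin ?t)\<bar> = real m"
    by (simp_all only: abs_mult abs_minus_cancel abs_of_nat mult_1)
  then show ?thesis by (simp add: abs_mult cheb_root_def)
qed

text \<open>
  Up to a common factor, the products over the other nodes in numerator and denominator are
  \<open>T\<^sub>m (y) / (y - y\<^sub>k)\<close> and the derivative of \<open>T\<^sub>m\<close> at \<open>y\<^sub>k\<close>.
\<close>
lemma lagrange_basis_cheb:
  assumes k: "k < m" and y: "y \<noteq> cheb_root m k"
  shows "\<bar>poly (lagrange_basis m (cheb_root m) k) y\<bar> =
     \<bar>poly (cheb m) y\<bar> * sin (cheb_angle m k) / (real m * \<bar>y - cheb_root m k\<bar>)"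
proof -
  let ?Q = "\<lambda>y. \<Prod>l\<in>{..<m} - {k}. y - cheb_root m l"
  obtain c where c: "c \<noteq> 0" "cheb m = Polynomial.smult c (\<Prod>l<m. [:- cheb_root m l, 1:])"
    using cheb_factorization[of m] k by auto
  have split: "poly (cheb m) z = c * ((z - cheb_root m k) * ?Q z)" for z
  proof -
    have "poly (cheb m) z = c * (\<Prod>l<m. z - cheb_root m l)" by (simp add: c(2) poly_prod)
    also have "(\<Prod>l<m. z - cheb_root m l) = (z - cheb_root m k) * ?Q z"
      using k by (intro prod.remove) auto
    finally show ?thesis .
  qed
  define R where "R = Polynomial.smult c (\<Prod>l\<in>{..<m} - {k}. [:- cheb_root m l, 1:])"
  have "cheb m = [:- cheb_root m k, 1:] * R"
    unfolding c(2) R_def by (subst prod.remove[of _ k]) (use k in \<open>auto simp del: mult_pCons_left\<close>)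
  then have "poly (pderiv (cheb m)) (cheb_root m k) = c * ?Q (cheb_root m k)"
    by (simp add: pderiv_mult pderiv_pCons del: mult_pCons_left) (simp add: R_def poly_prod)
  then have "\<bar>c\<bar> * \<bar>?Q (cheb_root m k)\<bar> * sin (cheb_angle m k) = real m"
    using pderiv_cheb_root[OF k] by (simp add: abs_mult)
  note dQ = this
  have "\<bar>?Q (cheb_root m k)\<bar> \<noteq> 0"
  proof
    assume "\<bar>?Q (cheb_root m k)\<bar> = 0"
    then show False using dQ k by (simp only: mult_zero_right mult_zero_left)
  qed
  have "\<bar>poly (cheb m) y\<bar> = \<bar>c\<bar> * (\<bar>y - cheb_root m k\<bar> * \<bar>?Q y\<bar>)"
    by (simp add: split abs_mult)
  then have "\<bar>poly (cheb m) y\<bar> * sin (cheb_angle m k) / (real m * \<bar>y - cheb_root m k\<bar>)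
      = \<bar>c\<bar> * \<bar>?Q y\<bar> * sin (cheb_angle m k) / real m"
    using y by (simp add: field_simps)
  also have "\<dots> = \<bar>?Q y\<bar> / \<bar>?Q (cheb_root m k)\<bar>"
  proof -
    have quot: "A * C * s / M = C / B" if "A * B * s = M" "B \<noteq> 0" "M \<noteq> 0" for A B C M s :: real
    proof -
      have "A * C * s * B = C * M" unfolding that(1)[symmetric] by (simp only: ac_simps)
      then show ?thesis using that(2,3) by (simp add: frac_eq_eq)
    qed
    show ?thesis by (rule quot[OF dQ]) (use \<open>\<bar>?Q (cheb_root m k)\<bar> \<noteq> 0\<close> k in auto)
  qed
  finally show ?thesis by (simp add: poly_lagrange_basis)
qed

text \<open>
  With half the angle, \<open>h\<close>, this is \<open>cos h \<le> 2 m sin h\<close>, which follows from \<open>h \<le> tan h\<close> and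
  \<open>h \<ge> \<pi> / (4 m)\<close>. It makes the Lagrange basis polynomials to the right of \<open>1\<close> at most twice as
  large as \<open>T\<^sub>m\<close>, uniformly in \<open>m\<close>.
\<close>
lemma sin_le_1_minus_cos:
  assumes "k < m"
  shows "sin (cheb_angle m k) \<le> 2 * real m * (1 - cheb_root m k)"
proof -
  define h where "h = cheb_angle m k / 2"
  have h: "pi / (4 * real m) \<le> h" "h < pi / 2"
    using cheb_angle_bounds[OF assms] by (auto simp: h_def field_simps)
  have h0: "h > 0"
  proof -
    have "0 < pi / (4 * real m)" using assms by simp
    then show ?thesis using h(1) by linarith
  qed
  have c0: "cos h > 0" using h h0 by (intro cos_gt_zero) auto
  have s0: "sin h > 0" using h h0 by (intro sin_gt_zero) auto
  have "h \<le> tan h"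
    using abs_tan_ge[of h] h h0 c0 s0 by (simp add: tan_def)
  then have "h * cos h \<le> sin h" using c0 by (simp add: tan_def field_simps)
  have "1 \<le> 2 * real m * h"
  proof -
    have "pi / 2 \<le> 2 * real m * h" using h(1) assms by (simp add: field_simps)
    then show ?thesis using pi_gt3 by linarith
  qed
  then have "cos h \<le> 2 * real m * h * cos h" using c0 by simp
  also have "\<dots> \<le> 2 * real m * sin h" using \<open>h * cos h \<le> sin h\<close> by (simp add: mult_left_mono mult.assoc)
  finally have "cos h * sin h \<le> 2 * real m * sin h * sin h" using s0 by simp
  moreover have "sin (cheb_angle m k) = 2 * sin h * cos h" using sin_double[of h] by (simp add: h_def)
  moreover have "cheb_root m k = 1 - 2 * (sin h)\<^sup>2" using cos_double_sin[of h] by (simp add: h_def cheb_root_def)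
  ultimately show ?thesis by (simp add: power2_eq_square mult.assoc mult.left_commute mult.commute)
qed

lemma lagrange_basis_cheb_le:
  assumes "k < m" "1 \<le> y"
  shows "\<bar>poly (lagrange_basis m (cheb_root m) k) y\<bar> \<le> 2 * \<bar>poly (cheb m) y\<bar>"
proof -
  have "sin (cheb_angle m k) > 0"
  proof (rule sin_gt_zero)
    have "0 < pi / (2 * real m)" using assms by simp
    then show "0 < cheb_angle m k" using cheb_angle_bounds(1)[OF assms(1)] by linarith
  qed (use cheb_angle_bounds[OF assms(1)] in simp)
  then have lt: "0 < 2 * real m * (1 - cheb_root m k)" using sin_le_1_minus_cos[OF assms(1)] by linarith
  then have lt1: "cheb_root m k < 1" using assms by (simp add: zero_less_mult_iff)
  have "sin (cheb_angle m k) \<le> 2 * (real m * (y - cheb_root m k))"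
  proof -
    have "real m * (1 - cheb_root m k) \<le> real m * (y - cheb_root m k)"
      using assms by (intro mult_left_mono) auto
    then show ?thesis using sin_le_1_minus_cos[OF assms(1)] by linarith
  qed
  then have "sin (cheb_angle m k) / (real m * \<bar>y - cheb_root m k\<bar>) \<le> 2"
    using lt1 assms by (simp add: divide_le_eq)
  then have "\<bar>poly (cheb m) y\<bar> * (sin (cheb_angle m k) / (real m * \<bar>y - cheb_root m k\<bar>)) \<le> \<bar>poly (cheb m) y\<bar> * 2"
    by (intro mult_left_mono) auto
  then show ?thesis using lagrange_basis_cheb[OF assms(1), of y] lt1 assms by simp
qed

text \<open>
  The Chebyshev nodes of the interval \<open>[0, r]\<close>, in decreasing order.
\<close>
definition cheb_node :: "real \<Rightarrow> nat \<Rightarrow> nat \<Rightarrow> real" where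
  "cheb_node r m k = r * (1 + cheb_root m k) / 2"

lemma cheb_node_bounds:
  assumes "0 \<le> r"
  shows "0 \<le> cheb_node r m k" "cheb_node r m k \<le> r"
proof -
  have "cheb_root m k \<ge> -1" "cheb_root m k \<le> 1" by (auto simp: cheb_root_def)
  then show "0 \<le> cheb_node r m k" "cheb_node r m k \<le> r"
    using assms by (auto simp: cheb_node_def mult_left_le intro!: mult_nonneg_nonneg)
      (rule mult_left_mono, auto)
qed

lemma cheb_node_less:
  assumes "0 < r" "k < l" "l < m"
  shows "cheb_node r m l < cheb_node r m k"
  using cheb_root_less[OF assms(2,3)] assms(1) by (simp add: cheb_node_def)

text \<open>
  The affine map from \<open>[0, r]\<close> to \<open>[-1, 1]\<close> takes \<open>1\<close> to \<open>2 / r - 1\<close>. This is the preimage of that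
  point outside the unit disc under the Joukowski map, so \<open>T\<^sub>m\<close> is at most its \<open>m\<close>-th power there.
\<close>
definition cheb_growth :: "real \<Rightarrow> real" where
  "cheb_growth r = (1 + sqrt (1 - r)) / (1 - sqrt (1 - r))"

lemma cheb_growth_ge_1:
  assumes "0 < r" "r \<le> 1"
  shows "1 \<le> cheb_growth r"
proof -
  have "sqrt (1 - r) < 1" "0 \<le> sqrt (1 - r)" using assms by (auto simp: real_sqrt_lt_1_iff)
  then show ?thesis by (simp add: cheb_growth_def)
qed

text \<open>
  A polynomial that is small at the nodes of \<open>[0, r]\<close> cannot be large at \<open>1\<close>: expand it in the Lagrange
  basis, bound the basis at \<open>1\<close> and use the Cauchy-Schwarz inequality.
\<close>
lemma cheb_extrapolation:
  assumes r: "0 < r" "r \<le> 1" and m: "m \<ge> 1" and p: "degree p < m"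
  shows "(poly p 1)\<^sup>2 \<le> 4 * real m * cheb_growth r ^ (2 * m) * (\<Sum>k<m. (poly p (cheb_node r m k))\<^sup>2)"
proof -
  define y where "y = 2 / r - 1"
  define Z where "Z = cheb_growth r"
  define u where "u = sqrt (1 - r)"
  have u: "0 \<le> u" "u < 1" "r = 1 - u\<^sup>2" using r by (auto simp: u_def real_sqrt_lt_1_iff)
  have Z1: "1 \<le> Z" unfolding Z_def by (rule cheb_growth_ge_1[OF r])
  have y1: "1 \<le> y" using r by (simp add: y_def field_simps)
  have yZ: "y = (Z + 1 / Z) / 2"
  proof -
    have "1 - u\<^sup>2 \<noteq> 0" "1 - u \<noteq> 0" "1 + u \<noteq> 0" using u r by auto
    have "(Z + 1 / Z) / 2 = ((1 + u)\<^sup>2 + (1 - u)\<^sup>2) / (2 * ((1 + u) * (1 - u)))"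
      unfolding Z_def cheb_growth_def u_def[symmetric]
      using \<open>1 - u \<noteq> 0\<close> \<open>1 + u \<noteq> 0\<close> by (simp add: field_simps power2_eq_square)
    also have "\<dots> = (1 + u\<^sup>2) / (1 - u\<^sup>2)"
    proof -
      have num: "(1 + u)\<^sup>2 + (1 - u)\<^sup>2 = 2 * (1 + u\<^sup>2)" and den: "2 * ((1 + u) * (1 - u)) = 2 * (1 - u\<^sup>2)"
        by (simp_all add: power2_eq_square algebra_simps)
      show ?thesis unfolding num den by (rule mult_divide_mult_cancel_left) simp
    qed
    also have "\<dots> = y" unfolding y_def u(3) using \<open>1 - u\<^sup>2 \<noteq> 0\<close> by (simp add: field_simps)
    finally show ?thesis by simp
  qed
  have cheb: "\<bar>poly (cheb m) y\<bar> \<le> Z ^ m"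
  proof -
    define w where "w = 1 / Z ^ m"
    have "poly (cheb m) y = (Z ^ m + w) / 2"
      unfolding yZ w_def using Z1 by (intro poly_cheb_joukowski) auto
    moreover have z: "1 \<le> Z ^ m" using Z1 by (rule one_le_power)
    moreover have "w \<le> 1" "0 \<le> w" using z by (auto simp: w_def divide_le_eq)
    ultimately have "- (Z ^ m) \<le> poly (cheb m) y" "poly (cheb m) y \<le> Z ^ m" by simp_all
    then show ?thesis by (simp add: abs_le_iff)
  qed
  let ?x = "cheb_node r m"
  have inj: "inj_on ?x {..<m}"
    using inj_cheb_root[of m] r by (auto simp: inj_on_def cheb_node_def)
  have basis: "\<bar>poly (lagrange_basis m ?x k) 1\<bar> \<le> 2 * Z ^ m" if k: "k < m" for k
  proof -
    have "poly (lagrange_basis m ?x k) 1 = poly (lagrange_basis m (cheb_root m) k) y"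
      unfolding poly_lagrange_basis prod_dividef[symmetric]
    proof (rule prod.cong[OF refl])
      fix l assume l: "l \<in> {..<m} - {k}"
      have a: "1 - ?x l = (r / 2) * (y - cheb_root m l)"
        using r by (simp add: cheb_node_def y_def field_simps)
      have b: "?x k - ?x l = (r / 2) * (cheb_root m k - cheb_root m l)"
        by (simp add: cheb_node_def field_simps)
      show "(1 - ?x l) / (?x k - ?x l) = (y - cheb_root m l) / (cheb_root m k - cheb_root m l)"
        unfolding a b using r by simp
    qed
    then show ?thesis using lagrange_basis_cheb_le[OF k y1] cheb by linarith
  qed
  have "(poly p 1)\<^sup>2 = (\<Sum>k<m. poly p (?x k) * poly (lagrange_basis m ?x k) 1)\<^sup>2"
    using lagrange_interpolation[OF inj p, of 1] by simp
  also have "\<dots> \<le> (\<Sum>k<m. (poly p (?x k))\<^sup>2) * (\<Sum>k<m. (poly (lagrange_basis m ?x k) 1)\<^sup>2)"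
    by (rule Cauchy_Schwarz_ineq_sum)
  also have "\<dots> \<le> (\<Sum>k<m. (poly p (?x k))\<^sup>2) * (\<Sum>k<m. (2 * Z ^ m)\<^sup>2)"
  proof (intro mult_left_mono[OF _ sum_nonneg])
    show "(\<Sum>k<m. (poly (lagrange_basis m ?x k) 1)\<^sup>2) \<le> (\<Sum>k<m. (2 * Z ^ m)\<^sup>2)"
    proof (rule sum_mono)
      fix k assume "k \<in> {..<m}"
      then show "(poly (lagrange_basis m ?x k) 1)\<^sup>2 \<le> (2 * Z ^ m)\<^sup>2"
        using basis[of k] by (metis abs_ge_zero lessThan_iff power2_abs power_mono)
    qed
  qed simp
  also have "(\<Sum>k<m. (2 * Z ^ m)\<^sup>2) = 4 * real m * Z ^ (2 * m)"
    by (simp add: power_mult_distrib power_mult[symmetric] mult.commute)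
  finally show ?thesis unfolding Z_def by (simp add: mult.commute)
qed

section \<open>Gaussian integrals over cones\<close>

abbreviation leb :: "nat \<Rightarrow> (nat \<Rightarrow> real) measure" where
  "leb n \<equiv> \<Pi>\<^sub>M i\<in>{..<n}. lborel"

abbreviation sqnorm :: "nat \<Rightarrow> (nat \<Rightarrow> real) \<Rightarrow> real" where
  "sqnorm n x \<equiv> \<Sum>i<n. (x i)\<^sup>2"

definition shrink :: "nat \<Rightarrow> real \<Rightarrow> (nat \<Rightarrow> real) \<Rightarrow> nat \<Rightarrow> real" where
  "shrink n a x = (\<lambda>i\<in>{..<n}. x i / a)"

lemma product_sigma_finite_leb: "product_sigma_finite (\<lambda>_. lborel :: real measure)"
  by unfold_locales

lemma sigma_finite_leb: "sigma_finite_measure (leb n)"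
  by (rule product_sigma_finite.sigma_finite[OF product_sigma_finite_leb]) simp

lemma coord_measurable: "j < n \<Longrightarrow> (\<lambda>x. x j) \<in> borel_measurable (leb n)"
  using measurable_component_singleton[of j "{..<n}" "\<lambda>_. lborel :: real measure"] by simp

lemma measurable_shrink [measurable]: "shrink n a \<in> leb n \<rightarrow>\<^sub>M leb n"
  unfolding shrink_def by measurable

lemma emeasure_lborel_shrink:
  fixes A :: "real set"
  assumes "a > 0" and A [measurable]: "A \<in> sets borel"
  shows "emeasure lborel ((\<lambda>t. t / a) -` A) = ennreal a * emeasure lborel A"
proof -
  have [measurable]: "(\<lambda>t. t / a) -` A \<in> sets borel"
    by (rule measurable_sets_borel[OF _ A]) simp
  have "emeasure lborel ((\<lambda>t. t / a) -` A) = (\<integral>\<^sup>+t. indicator ((\<lambda>t. t / a) -` A) t \<partial>lborel)"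
    by simp
  also have "\<dots> = ennreal \<bar>a\<bar> * (\<integral>\<^sup>+t. indicator ((\<lambda>t. t / a) -` A) (0 + a * t) \<partial>lborel)"
    by (rule nn_integral_real_affine) (use assms in auto)
  also have "(\<lambda>t. indicator ((\<lambda>t. t / a) -` A) (0 + a * t) :: ennreal) = indicator A"
    using assms by (auto simp: indicator_def)
  finally show ?thesis using assms by simp
qed

text \<open>
  Both sides agree on boxes, by the one-dimensional scaling rule, and boxes determine the product
  measure.
\<close>
lemma distr_leb_shrink:
  assumes "a > 0"
  shows "distr (leb n) (leb n) (shrink n a) = density (leb n) (\<lambda>_. ennreal (a ^ n))"
proof -
  interpret product_sigma_finite "\<lambda>_. lborel :: real measure" by (rule product_sigma_finite_leb)
  define c where "c = ennreal (inverse (a ^ n))"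
  have "density (distr (leb n) (leb n) (shrink n a)) (\<lambda>_. c) = leb n"
  proof (rule PiM_eqI)
    fix A :: "nat \<Rightarrow> real set"
    assume "\<And>i. i \<in> {..<n} \<Longrightarrow> A i \<in> sets lborel"
    then have A: "\<And>i. i < n \<Longrightarrow> A i \<in> sets borel" by auto
    have AP: "Pi\<^sub>E {..<n} A \<in> sets (leb n)"
      by (rule sets_PiM_I_finite) (use A in auto)
    have vim: "shrink n a -` Pi\<^sub>E {..<n} A \<inter> space (leb n) = Pi\<^sub>E {..<n} (\<lambda>i. (\<lambda>t. t / a) -` A i)"
      by (auto simp: shrink_def space_PiM PiE_def Pi_def extensional_def)
    have "emeasure (density (distr (leb n) (leb n) (shrink n a)) (\<lambda>_. c)) (Pi\<^sub>E {..<n} A)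
        = c * emeasure (leb n) (shrink n a -` Pi\<^sub>E {..<n} A \<inter> space (leb n))"
      using AP by (simp add: emeasure_density nn_integral_cmult emeasure_distr)
    also have "\<dots> = c * (\<Prod>i<n. emeasure lborel ((\<lambda>t. t / a) -` A i))"
      unfolding vim
      by (subst emeasure_PiM) (use A measurable_sets_borel[of "\<lambda>t. t / a" borel] in auto)
    also have "(\<Prod>i<n. emeasure lborel ((\<lambda>t. t / a) -` A i)) = (\<Prod>i<n. ennreal a * emeasure lborel (A i))"
      by (rule prod.cong) (use A emeasure_lborel_shrink[OF assms] in auto)
    also have "\<dots> = ennreal (a ^ n) * (\<Prod>i<n. emeasure lborel (A i))"
      using assms by (simp add: prod.distrib ennreal_power)
    also have "c * \<dots> = (\<Prod>i<n. emeasure lborel (A i))"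
      using assms by (simp add: c_def mult.assoc[symmetric] ennreal_mult'[symmetric])
    finally show "emeasure (density (distr (leb n) (leb n) (shrink n a)) (\<lambda>_. c)) (Pi\<^sub>E {..<n} A)
      = (\<Prod>i\<in>{..<n}. emeasure lborel (A i))" .
  qed auto
  then have "density (leb n) (\<lambda>_. ennreal (a ^ n)) =
     density (density (distr (leb n) (leb n) (shrink n a)) (\<lambda>_. c)) (\<lambda>_. ennreal (a ^ n))" by simp
  also have "\<dots> = density (distr (leb n) (leb n) (shrink n a)) (\<lambda>_. c * ennreal (a ^ n))"
    by (rule density_density_eq) auto
  also have "c * ennreal (a ^ n) = 1"
    using assms by (simp add: c_def ennreal_mult'[symmetric])
  finally show ?thesis by (simp add: density_1)
qed

lemma emeasure_leb_shrink:
  assumes "a > 0" and [measurable]: "E \<in> sets (leb n)"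
  shows "emeasure (leb n) (shrink n a -` E \<inter> space (leb n)) = ennreal (a ^ n) * emeasure (leb n) E"
proof -
  have "emeasure (leb n) (shrink n a -` E \<inter> space (leb n)) = emeasure (distr (leb n) (leb n) (shrink n a)) E"
    by (simp add: emeasure_distr)
  also have "\<dots> = ennreal (a ^ n) * emeasure (leb n) E"
    unfolding distr_leb_shrink[OF assms(1)] by (simp add: emeasure_density nn_integral_cmult)
  finally show ?thesis .
qed

lemma nn_integral_exp_atLeast: "(\<integral>\<^sup>+s. ennreal (exp (- s)) * indicator {q..} s \<partial>lborel) = ennreal (exp (- q))"
proof -
  have "(\<integral>\<^sup>+s. ennreal (exp (- s)) * indicator {q..} s \<partial>lborel) = ennreal (0 - (- exp (- q)))"
  proof (rule nn_integral_FTC_atLeast)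
    show "((\<lambda>s::real. - exp (- s)) \<longlongrightarrow> 0) at_top"
    proof -
      have "((\<lambda>s::real. exp (- s)) \<longlongrightarrow> 0) at_top"
        by (rule filterlim_compose[OF exp_at_bot filterlim_uminus_at_bot_at_top])
      from tendsto_minus[OF this] show ?thesis by simp
    qed
  qed (auto intro!: derivative_eq_intros)
  then show ?thesis by simp
qed

text \<open>
  This is \<open>\<Gamma> (n / 2 + 1)\<close>, the factor between the Gaussian weight of a cone and the volume of its part in
  the unit ball. The same factor occurs for all cones, so it cancels in probabilities.
\<close>
definition ball_moment :: "nat \<Rightarrow> ennreal" where
  "ball_moment n = (\<integral>\<^sup>+s. ennreal (exp (- s) * sqrt s ^ n) * indicator {0<..} s \<partial>lborel)"

text \<open>
  The Gaussian density is a mixture of indicators of balls, \<open>exp (- q) = \<integral>\<^bsub>s \<ge> q\<^esub> exp (- s) ds\<close>, and the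
  part of a cone in the ball of radius \<open>\<surd>s\<close> is a scaled copy of its part in the unit ball. Hence the
  uniform distribution on the ball and the Gaussian measure give proportional weights to cones.
\<close>
lemma nn_integral_gaussian_cone:
  assumes F [measurable]: "F \<in> sets (leb n)"
    and cone: "\<And>x a. x \<in> space (leb n) \<Longrightarrow> a > 0 \<Longrightarrow> shrink n a x \<in> F \<longleftrightarrow> x \<in> F"
    and F0: "\<And>x. x \<in> F \<Longrightarrow> sqnorm n x > 0"
  shows "(\<integral>\<^sup>+x. ennreal (exp (- sqnorm n x)) * indicator F x \<partial>leb n) =
    emeasure (leb n) {x \<in> F. sqnorm n x \<le> 1} * ball_moment n"
proof -
  interpret L: sigma_finite_measure "leb n" by (rule sigma_finite_leb)
  interpret pair_sigma_finite lborel "leb n" by unfold_locales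
  have FE [measurable]: "{x \<in> F. sqnorm n x \<le> 1} \<in> sets (leb n)"
  proof -
    have "{x \<in> F. sqnorm n x \<le> 1} = F \<inter> {x \<in> space (leb n). sqnorm n x \<le> 1}"
      using sets.sets_into_space[OF F] by auto
    also have "\<dots> \<in> sets (leb n)" by measurable
    finally show ?thesis .
  qed
  \<comment> \<open>The layers of the Gaussian density over the cone, integrated in both orders.\<close>
  define h where "h = (\<lambda>(s::real, x). ennreal (exp (- s)) * indicator {sqnorm n x..} s * indicator F x)"
  have [measurable]: "h \<in> borel_measurable (lborel \<Otimes>\<^sub>M leb n)"
  proof -
    have "h = (\<lambda>p. ennreal (exp (- fst p)) * indicator {p \<in> space (lborel \<Otimes>\<^sub>M leb n). sqnorm n (snd p) \<le> fst p} p * indicator F (snd p))"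
      unfolding h_def using sets.sets_into_space[OF F]
      by (intro ext) (auto simp: indicator_def space_pair_measure split: prod.splits)
    also have "\<dots> \<in> borel_measurable (lborel \<Otimes>\<^sub>M leb n)" by measurable
    finally show ?thesis .
  qed
  have "(\<integral>\<^sup>+x. ennreal (exp (- sqnorm n x)) * indicator F x \<partial>leb n) =
      (\<integral>\<^sup>+x. (\<integral>\<^sup>+s. h (s, x) \<partial>lborel) \<partial>leb n)"
    by (rule nn_integral_cong)
      (simp add: h_def nn_integral_multc nn_integral_exp_atLeast)
  also have "\<dots> = (\<integral>\<^sup>+s. (\<integral>\<^sup>+x. h (s, x) \<partial>leb n) \<partial>lborel)"
    by (rule Fubini) simp
  also have "\<dots> = (\<integral>\<^sup>+s. emeasure (leb n) {x \<in> F. sqnorm n x \<le> 1} *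
      (ennreal (exp (- s) * sqrt s ^ n) * indicator {0<..} s) \<partial>lborel)"
  proof (rule nn_integral_cong)
    fix s :: real
    show "(\<integral>\<^sup>+x. h (s, x) \<partial>leb n) = emeasure (leb n) {x \<in> F. sqnorm n x \<le> 1} *
      (ennreal (exp (- s) * sqrt s ^ n) * indicator {0<..} s)"
    proof (cases "s > 0")
      case True
      \<comment> \<open>Shrinking by the square root of s maps this part of the cone to its part in the unit ball.\<close>
      have mem: "(x \<in> F \<and> sqnorm n x \<le> s) \<longleftrightarrow> shrink n (sqrt s) x \<in> {x \<in> F. sqnorm n x \<le> 1}"
        if "x \<in> space (leb n)" for x
      proof -
        have "sqnorm n (shrink n (sqrt s) x) = (\<Sum>i<n. (x i)\<^sup>2 / s)"
          using True by (intro sum.cong) (auto simp: shrink_def power_divide)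
        also have "\<dots> = sqnorm n x / s" by (simp add: sum_divide_distrib)
        finally show ?thesis using cone[OF that, of "sqrt s"] True by (simp add: divide_le_eq)
      qed
      have "(\<integral>\<^sup>+x. h (s, x) \<partial>leb n) =
          (\<integral>\<^sup>+x. ennreal (exp (- s)) * indicator (shrink n (sqrt s) -` {x \<in> F. sqnorm n x \<le> 1} \<inter> space (leb n)) x \<partial>leb n)"
        by (rule nn_integral_cong) (use mem in \<open>auto simp: h_def indicator_def\<close>)
      also have "\<dots> = ennreal (exp (- s)) * (ennreal (sqrt s ^ n) * emeasure (leb n) {x \<in> F. sqnorm n x \<le> 1})"
      proof -
        have "(\<integral>\<^sup>+x. ennreal (exp (- s)) * indicator (shrink n (sqrt s) -` {x \<in> F. sqnorm n x \<le> 1} \<inter> space (leb n)) x \<partial>leb n)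
          = ennreal (exp (- s)) * emeasure (leb n) (shrink n (sqrt s) -` {x \<in> F. sqnorm n x \<le> 1} \<inter> space (leb n))"
          by (rule nn_integral_cmult_indicator) (rule measurable_sets[OF measurable_shrink FE])
        also have "emeasure (leb n) (shrink n (sqrt s) -` {x \<in> F. sqnorm n x \<le> 1} \<inter> space (leb n))
          = ennreal (sqrt s ^ n) * emeasure (leb n) {x \<in> F. sqnorm n x \<le> 1}"
          by (rule emeasure_leb_shrink[OF _ FE]) (use True in simp)
        finally show ?thesis .
      qed
      finally have e: "(\<integral>\<^sup>+x. h (s, x) \<partial>leb n) =
          ennreal (exp (- s)) * (ennreal (sqrt s ^ n) * emeasure (leb n) {x \<in> F. sqnorm n x \<le> 1})" .
      have "ennreal (exp (- s) * sqrt s ^ n) = ennreal (exp (- s)) * ennreal (sqrt s ^ n)"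
        using True by (intro ennreal_mult) auto
      then show ?thesis unfolding e using True by (simp add: ac_simps)
    next
      case False
      have "h (s, x) = 0" for x
        using F0[of x] False by (auto simp: h_def indicator_def)
      then show ?thesis using False by simp
    qed
  qed
  also have "\<dots> = emeasure (leb n) {x \<in> F. sqnorm n x \<le> 1} * ball_moment n"
    unfolding ball_moment_def by (rule nn_integral_cmult) simp
  finally show ?thesis .
qed

lemma nn_integral_gaussian_1d:
  assumes "c > 0"
  shows "(\<integral>\<^sup>+t. ennreal (exp (- (c * t\<^sup>2))) \<partial>lborel) = ennreal (sqrt (pi / c))"
proof -
  define \<sigma> where "\<sigma> = sqrt (1 / (2 * c))"
  have s: "\<sigma> > 0" "\<sigma>\<^sup>2 = 1 / (2 * c)" using assms by (simp_all add: \<sigma>_def)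
  have eq: "exp (- (c * t\<^sup>2)) = sqrt (pi / c) * normal_density 0 \<sigma> t" for t
    using assms by (simp add: normal_density_def s field_simps real_sqrt_divide real_sqrt_mult)
  interpret prob_space "density lborel (normal_density 0 \<sigma>)"
    by (rule prob_space_normal_density[OF s(1)])
  have "(\<integral>\<^sup>+t. ennreal (normal_density 0 \<sigma> t) \<partial>lborel) = 1"
    using emeasure_space_1 by (simp add: emeasure_density)
  then show ?thesis
    unfolding eq using assms by (simp add: ennreal_mult nn_integral_cmult)
qed

lemma nn_integral_gaussian_product:
  assumes "\<And>i. i < n \<Longrightarrow> c i > 0"
  shows "(\<integral>\<^sup>+x. ennreal (exp (- (\<Sum>i<n. c i * (x i)\<^sup>2))) \<partial>leb n) = ennreal (\<Prod>i<n. sqrt (pi / c i))"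
proof -
  interpret product_sigma_finite "\<lambda>_. lborel :: real measure" by (rule product_sigma_finite_leb)
  have "(\<integral>\<^sup>+x. ennreal (exp (- (\<Sum>i<n. c i * (x i)\<^sup>2))) \<partial>leb n) =
      (\<integral>\<^sup>+x. (\<Prod>i<n. ennreal (exp (- (c i * (x i)\<^sup>2)))) \<partial>leb n)"
    by (simp add: prod_ennreal exp_sum sum_negf[symmetric])
  also have "\<dots> = (\<Prod>i<n. \<integral>\<^sup>+t. ennreal (exp (- (c i * t\<^sup>2))) \<partial>lborel)"
    by (rule product_nn_integral_prod) auto
  also have "\<dots> = (\<Prod>i<n. ennreal (sqrt (pi / c i)))"
    by (rule prod.cong) (use assms nn_integral_gaussian_1d in auto)
  also have "\<dots> = ennreal (\<Prod>i<n. sqrt (pi / c i))"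
    using assms by (intro prod_ennreal) (auto intro!: divide_nonneg_pos)
  finally show ?thesis .
qed

lemma emeasure_coord_zero:
  assumes "j < n"
  shows "emeasure (leb n) {x \<in> space (leb n). x j = 0} = 0"
proof -
  interpret product_sigma_finite "\<lambda>_. lborel :: real measure" by (rule product_sigma_finite_leb)
  have "{x \<in> space (leb n). x j = 0} = Pi\<^sub>E {..<n} (\<lambda>i. if i = j then {0} else UNIV)"
    using assms by (auto simp: space_PiM PiE_def Pi_def split: if_splits)
  also have "emeasure (leb n) \<dots> = (\<Prod>i<n. emeasure lborel (if i = j then {0} else UNIV :: real set))"
    by (rule emeasure_PiM) auto
  also have "\<dots> = 0" using assms by (intro prod_zero) (auto intro!: bexI[of _ j])
  finally show ?thesis .
qed

section \<open>The uniform distribution on the sphere\<close>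

text \<open>
  The unit ball without the origin, so that normalisation is defined everywhere on it.
\<close>
abbreviation unif_ball :: "nat \<Rightarrow> (nat \<Rightarrow> real) measure" where
  "unif_ball n \<equiv> uniform_measure (leb n) {x \<in> space (leb n). 0 < sqnorm n x \<and> sqnorm n x \<le> 1}"

lemma ball_times_moment:
  assumes "n \<ge> 1"
  shows "emeasure (leb n) {x \<in> space (leb n). 0 < sqnorm n x \<and> sqnorm n x \<le> 1} * ball_moment n
           = ennreal (sqrt pi ^ n)"
proof -
  let ?F = "{x \<in> space (leb n). 0 < sqnorm n x}"
  have F: "?F \<in> sets (leb n)" by measurable
  have cone: "shrink n a x \<in> ?F \<longleftrightarrow> x \<in> ?F" if x: "x \<in> space (leb n)" and a: "a > 0" for x a
  proof -
    have "sqnorm n (shrink n a x) = (\<Sum>i<n. (x i)\<^sup>2 / a\<^sup>2)"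
      by (intro sum.cong) (auto simp: shrink_def power_divide)
    also have "\<dots> = sqnorm n x / a\<^sup>2" by (simp add: sum_divide_distrib)
    finally show ?thesis using x a measurable_space[OF measurable_shrink x] by (simp add: zero_less_divide_iff)
  qed
  have "ennreal (sqrt pi ^ n) = (\<integral>\<^sup>+x. ennreal (exp (- (\<Sum>i<n. 1 * (x i)\<^sup>2))) \<partial>leb n)"
    by (subst nn_integral_gaussian_product) auto
  also have "\<dots> = (\<integral>\<^sup>+x. ennreal (exp (- sqnorm n x)) * indicator ?F x \<partial>leb n)"
  proof (rule nn_integral_cong_AE)
    have 1: "AE x in leb n. \<not> x 0 = 0"
    proof (rule AE_I[of _ _ "{x \<in> space (leb n). x 0 = 0}"])
      show "emeasure (leb n) {x \<in> space (leb n). x 0 = 0} = 0"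
        using emeasure_coord_zero[of 0 n] assms by simp
      have "(\<lambda>x. x 0) \<in> borel_measurable (leb n)" using assms by (intro coord_measurable) simp
      then show "{x \<in> space (leb n). x 0 = 0} \<in> sets (leb n)" by measurable
    qed auto
    have 2: "sqnorm n x > 0" if "x 0 \<noteq> 0" for x
      by (rule sum_pos2[of _ 0]) (use assms that in auto)
    show "AE x in leb n. ennreal (exp (- (\<Sum>i<n. 1 * (x i)\<^sup>2))) =
        ennreal (exp (- sqnorm n x)) * indicator ?F x"
      using 1 AE_space by eventually_elim (use 2 in \<open>auto simp: indicator_def\<close>)
  qed
  also have "\<dots> = emeasure (leb n) {x \<in> ?F. sqnorm n x \<le> 1} * ball_moment n"
    by (rule nn_integral_gaussian_cone[OF F cone]) auto
  finally show ?thesis by (simp add: conj_assoc)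
qed

lemma ball_sets: "{x \<in> space (leb n). 0 < sqnorm n x \<and> sqnorm n x \<le> 1} \<in> sets (leb n)"
  by measurable

lemma ball_finite_pos:
  assumes "n \<ge> 1"
  shows "emeasure (leb n) {x \<in> space (leb n). 0 < sqnorm n x \<and> sqnorm n x \<le> 1} \<noteq> 0"
    "emeasure (leb n) {x \<in> space (leb n). 0 < sqnorm n x \<and> sqnorm n x \<le> 1} \<noteq> \<infinity>"
    "ball_moment n \<noteq> 0" "ball_moment n \<noteq> \<infinity>"
proof -
  have pos: "ennreal (sqrt pi ^ n) \<noteq> 0" "ennreal (sqrt pi ^ n) \<noteq> \<infinity>" by auto
  show 1: "emeasure (leb n) {x \<in> space (leb n). 0 < sqnorm n x \<and> sqnorm n x \<le> 1} \<noteq> 0"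
    and 2: "ball_moment n \<noteq> 0"
    using pos ball_times_moment[OF assms] by force+
  show "emeasure (leb n) {x \<in> space (leb n). 0 < sqnorm n x \<and> sqnorm n x \<le> 1} \<noteq> \<infinity>"
    "ball_moment n \<noteq> \<infinity>"
    using 1 2 pos ball_times_moment[OF assms] by (auto simp: ennreal_mult_eq_top_iff)
qed

lemma prob_space_unif_ball:
  assumes "n \<ge> 1"
  shows "prob_space (unif_ball n)"
  by (rule prob_space_uniform_measure) (use ball_finite_pos[OF assms] in auto)

text \<open>
  Events that are invariant under scaling have the same probability under the uniform distribution on
  the ball as under the normalised Gaussian measure with density \<open>exp (- \<parallel>x\<parallel>\<^sup>2)\<close>, whose coordinates
  are independent.
\<close>
lemma unif_ball_cone_le:
  assumes n: "n \<ge> 1" and F: "F \<in> sets (leb n)"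
    and cone: "\<And>x a. x \<in> space (leb n) \<Longrightarrow> a > 0 \<Longrightarrow> shrink n a x \<in> F \<longleftrightarrow> x \<in> F"
    and F0: "\<And>x. x \<in> F \<Longrightarrow> sqnorm n x > 0"
    and c: "c \<ge> 0"
    and le: "(\<integral>\<^sup>+x. ennreal (exp (- sqnorm n x)) * indicator F x \<partial>leb n) \<le> ennreal (c * sqrt pi ^ n)"
  shows "emeasure (unif_ball n) F \<le> ennreal c"
proof -
  let ?S = "{x \<in> space (leb n). 0 < sqnorm n x \<and> sqnorm n x \<le> 1}"
  have SF: "?S \<inter> F = {x \<in> F. sqnorm n x \<le> 1}"
    using F0 sets.sets_into_space[OF F] by auto
  have "(\<integral>\<^sup>+x. ennreal (exp (- sqnorm n x)) * indicator F x \<partial>leb n) =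
      emeasure (leb n) {x \<in> F. sqnorm n x \<le> 1} * ball_moment n"
    by (rule nn_integral_gaussian_cone[OF F cone F0])
  then have 1: "emeasure (leb n) (?S \<inter> F) * ball_moment n \<le> ennreal c * ennreal (sqrt pi ^ n)"
    using le c unfolding SF by (simp add: ennreal_mult)
  have "emeasure (leb n) (?S \<inter> F) \<le> ennreal c * emeasure (leb n) ?S"
  proof (rule ccontr)
    assume "\<not> ?thesis"
    then have "ennreal c * emeasure (leb n) ?S < emeasure (leb n) (?S \<inter> F)" by simp
    then have "ball_moment n * (ennreal c * emeasure (leb n) ?S) < ball_moment n * emeasure (leb n) (?S \<inter> F)"
      using ball_finite_pos(3,4)[OF n] by (intro ennreal_mult_strict_left_mono) (auto simp: less_top zero_less_iff_neq_zero)
    also have "\<dots> \<le> ennreal c * (emeasure (leb n) ?S * ball_moment n)"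
      using 1 ball_times_moment[OF n] by (simp add: mult.commute)
    finally show False by (simp add: ac_simps)
  qed
  then have "emeasure (leb n) (?S \<inter> F) / emeasure (leb n) ?S \<le> ennreal c * emeasure (leb n) ?S / emeasure (leb n) ?S"
    by (rule divide_right_mono_ennreal)
  also have "\<dots> = ennreal c"
    using ball_finite_pos(1,2)[OF n] by (simp add: ennreal_mult_divide_eq)
  finally show ?thesis
    using F by (simp add: emeasure_uniform_measure[OF ball_sets])
qed

lemma dominated_event_sets:
  assumes n: "n \<ge> 1" and J: "J \<subseteq> {1..<n}"
  shows "{x \<in> space (leb n). (x 0)\<^sup>2 > \<beta> * (\<Sum>j\<in>J. (x j)\<^sup>2)} \<in> sets (leb n)"
proof -
  have [measurable]: "(\<lambda>x. x 0) \<in> borel_measurable (leb n)" using n by (intro coord_measurable) simp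
  have [measurable]: "(\<lambda>x. \<Sum>j\<in>J. (x j)\<^sup>2) \<in> borel_measurable (leb n)"
    using J by (intro borel_measurable_sum borel_measurable_power coord_measurable) auto
  show ?thesis by measurable
qed

text \<open>
  A Chernoff bound. On the event, \<open>exp (3/4 ((x 0)\<^sup>2 - \<beta> \<Sum>\<^bsub>j \<in> J\<^esub> (x j)\<^sup>2))\<close> is at least \<open>1\<close>, and its Gaussian
  expectation is a product of one-dimensional integrals. A single coordinate is hence unlikely to
  dominate a sum of many.
\<close>
lemma unif_ball_dominated_le:
  assumes n: "n \<ge> 1" and J: "J \<subseteq> {1..<n}" and \<beta>: "\<beta> \<ge> 0"
  shows "emeasure (unif_ball n) {x \<in> space (leb n). (x 0)\<^sup>2 > \<beta> * (\<Sum>j\<in>J. (x j)\<^sup>2)}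
           \<le> ennreal (2 / sqrt (1 + 3 / 4 * \<beta>) ^ card J)"
proof (rule unif_ball_cone_le[OF n])
  let ?F = "{x \<in> space (leb n). (x 0)\<^sup>2 > \<beta> * (\<Sum>j\<in>J. (x j)\<^sup>2)}"
  have fin: "finite J" using J finite_subset by blast
  have Jn: "j < n" "j \<noteq> 0" if "j \<in> J" for j using J that by auto
  show "?F \<in> sets (leb n)" by (rule dominated_event_sets[OF n J])
  show "0 \<le> 2 / sqrt (1 + 3 / 4 * \<beta>) ^ card J" using \<beta> by simp
  show "shrink n a x \<in> ?F \<longleftrightarrow> x \<in> ?F" if x: "x \<in> space (leb n)" and a: "a > 0" for x a
  proof -
    have "(\<Sum>j\<in>J. (shrink n a x j)\<^sup>2) = (\<Sum>j\<in>J. (x j)\<^sup>2 / a\<^sup>2)"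
      by (intro sum.cong) (auto simp: shrink_def power_divide Jn)
    also have "\<dots> = (\<Sum>j\<in>J. (x j)\<^sup>2) / a\<^sup>2" by (simp add: sum_divide_distrib)
    finally have e: "(\<Sum>j\<in>J. (shrink n a x j)\<^sup>2) = (\<Sum>j\<in>J. (x j)\<^sup>2) / a\<^sup>2" .
    have "(shrink n a x 0)\<^sup>2 = (x 0)\<^sup>2 / a\<^sup>2" using n by (simp add: shrink_def power_divide)
    then show ?thesis using x a measurable_space[OF measurable_shrink x]
      by (simp add: e divide_less_cancel)
  qed
  show pos: "0 < sqnorm n x" if "x \<in> ?F" for x
  proof (rule sum_pos2[of _ 0])
    have "0 \<le> \<beta> * (\<Sum>j\<in>J. (x j)\<^sup>2)" using \<beta> by (simp add: sum_nonneg)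
    then show "0 < (x 0)\<^sup>2" using that by auto
  qed (use n in auto)
  \<comment> \<open>The quadratic form after tilting by 3/4 ((x 0)^2 - \<beta> \<Sum> (x j)^2), positive definite since 3/4 < 1.\<close>
  define c where "c = (\<lambda>i. if i = 0 then 1 / 4 else if i \<in> J then 1 + 3 / 4 * \<beta> else (1::real))"
  have c: "c i > 0" for i using \<beta> by (simp add: c_def add_pos_nonneg)
  have sub: "insert 0 J \<subseteq> {..<n}" using J n by auto
  have csum: "(\<Sum>i<n. c i * (x i)\<^sup>2) = sqnorm n x - 3 / 4 * ((x 0)\<^sup>2 - \<beta> * (\<Sum>j\<in>J. (x j)\<^sup>2))" for x
  proof -
    have "(\<Sum>i<n. c i * (x i)\<^sup>2) - sqnorm n x = (\<Sum>i<n. (c i - 1) * (x i)\<^sup>2)"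
      by (simp add: sum_subtractf left_diff_distrib)
    also have "\<dots> = (\<Sum>i\<in>insert 0 J. (c i - 1) * (x i)\<^sup>2)"
      by (rule sum.mono_neutral_right) (use sub in \<open>auto simp: c_def\<close>)
    also have "\<dots> = - (3 / 4) * (x 0)\<^sup>2 + (\<Sum>i\<in>J. (c i - 1) * (x i)\<^sup>2)"
      using fin Jn by (subst sum.insert) (auto simp: c_def)
    also have "(\<Sum>i\<in>J. (c i - 1) * (x i)\<^sup>2) = (\<Sum>i\<in>J. 3 / 4 * \<beta> * (x i)\<^sup>2)"
      by (rule sum.cong) (use Jn in \<open>auto simp: c_def\<close>)
    also have "\<dots> = 3 / 4 * \<beta> * (\<Sum>i\<in>J. (x i)\<^sup>2)" by (simp add: sum_distrib_left)
    finally show ?thesis by (simp add: algebra_simps)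
  qed
  have "(\<integral>\<^sup>+x. ennreal (exp (- sqnorm n x)) * indicator ?F x \<partial>leb n)
      \<le> (\<integral>\<^sup>+x. ennreal (exp (- (\<Sum>i<n. c i * (x i)\<^sup>2))) \<partial>leb n)"
    by (rule nn_integral_mono) (auto simp: csum indicator_def intro!: ennreal_leI)
  also have "\<dots> = ennreal (\<Prod>i<n. sqrt (pi / c i))"
    by (rule nn_integral_gaussian_product) (rule c)
  also have "(\<Prod>i<n. sqrt (pi / c i)) = (\<Prod>i<n. sqrt pi) * (\<Prod>i<n. 1 / sqrt (c i))"
    by (subst prod.distrib[symmetric]) (simp add: real_sqrt_divide)
  also have "(\<Prod>i<n. 1 / sqrt (c i)) = (\<Prod>i\<in>insert 0 J. 1 / sqrt (c i))"
    by (rule prod.mono_neutral_right) (use sub in \<open>auto simp: c_def\<close>)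
  also have "\<dots> = 2 * (\<Prod>i\<in>J. 1 / sqrt (c i))"
    using fin Jn by (subst prod.insert) (auto simp: c_def real_sqrt_divide)
  also have "(\<Prod>i\<in>J. 1 / sqrt (c i)) = (\<Prod>i\<in>J. 1 / sqrt (1 + 3 / 4 * \<beta>))"
    by (rule prod.cong) (use Jn in \<open>auto simp: c_def\<close>)
  also have "\<dots> = 1 / sqrt (1 + 3 / 4 * \<beta>) ^ card J" by (simp add: power_one_over)
  finally show "(\<integral>\<^sup>+x. ennreal (exp (- sqnorm n x)) * indicator ?F x \<partial>leb n)
      \<le> ennreal (2 / sqrt (1 + 3 / 4 * \<beta>) ^ card J * sqrt pi ^ n)"
    by (simp add: mult.commute)
qed

definition coords :: "nat \<Rightarrow> real Matrix.vec \<Rightarrow> nat \<Rightarrow> real" where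
  "coords n b = (\<lambda>i\<in>{..<n}. vec_index b i)"

lemma coords_space: "coords n b \<in> space (leb n)"
  by (simp add: coords_def space_PiM)

lemma coords_measurable [measurable]: "coords n \<in> borel_vec n \<rightarrow>\<^sub>M leb n"
proof -
  have "coords n \<in> borel_vec n \<rightarrow>\<^sub>M (\<Pi>\<^sub>M i\<in>{..<n}. borel)"
    unfolding borel_vec_def coords_def by (rule measurable_vimage_algebra1) (auto simp: space_PiM)
  moreover have "sets (\<Pi>\<^sub>M i\<in>{..<n}. borel :: real measure) = sets (leb n)"
    by (rule sets_PiM_cong) auto
  ultimately show ?thesis by (simp cong: measurable_cong_sets)
qed

lemma space_borel_vec: "space (borel_vec n) = carrier_vec n"
  by (simp add: borel_vec_def space_vimage_algebra)

lemma unit_sphere_coords: "unit_sphere n = {b \<in> carrier_vec n. sqnorm n (coords n b) = 1}"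
  unfolding unit_sphere_def by (auto simp: scalar_prod_self coords_def)

lemma sets_borel_vec_coords:
  assumes "{x \<in> space (leb n). Q x} \<in> sets (leb n)"
  shows "{b \<in> carrier_vec n. Q (coords n b)} \<in> sets (borel_vec n)"
proof -
  have "coords n -` {x \<in> space (leb n). Q x} \<inter> space (borel_vec n) \<in> sets (borel_vec n)"
    by (rule measurable_sets[OF coords_measurable assms])
  also have "coords n -` {x \<in> space (leb n). Q x} \<inter> space (borel_vec n) = {b \<in> carrier_vec n. Q (coords n b)}"
    by (auto simp: space_borel_vec coords_space)
  finally show ?thesis .
qed

lemma unit_sphere_sets: "unit_sphere n \<in> sets (borel_vec n)"
  unfolding unit_sphere_coords by (rule sets_borel_vec_coords) measurable

definition normalize_vec :: "nat \<Rightarrow> (nat \<Rightarrow> real) \<Rightarrow> real Matrix.vec" where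
  "normalize_vec n x = Matrix.vec n (\<lambda>i. x i / sqrt (sqnorm n x))"

lemma normalize_vec_carrier: "normalize_vec n x \<in> carrier_vec n"
  by (simp add: normalize_vec_def)

lemma coords_normalize_vec: "coords n (normalize_vec n x) = shrink n (sqrt (sqnorm n x)) x"
  by (auto simp: coords_def normalize_vec_def shrink_def)

lemma normalize_vec_measurable [measurable]: "normalize_vec n \<in> leb n \<rightarrow>\<^sub>M borel_vec n"
  unfolding borel_vec_def
proof (rule measurable_vimage_algebra2)
  show "normalize_vec n \<in> space (leb n) \<rightarrow> carrier_vec n" by (simp add: normalize_vec_def)
  have "(\<lambda>x. \<lambda>i\<in>{..<n}. vec_index (normalize_vec n x) i) = (\<lambda>x. \<lambda>i\<in>{..<n}. x i / sqrt (sqnorm n x))"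
    by (auto simp: normalize_vec_def restrict_def fun_eq_iff)
  also have "\<dots> \<in> leb n \<rightarrow>\<^sub>M (\<Pi>\<^sub>M i\<in>{..<n}. borel)" by measurable
  finally show "(\<lambda>x. \<lambda>i\<in>{..<n}. vec_index (normalize_vec n x) i) \<in> leb n \<rightarrow>\<^sub>M (\<Pi>\<^sub>M i\<in>{..<n}. borel)" .
qed

lemma uniform_sphere_alt:
  "uniform_sphere n = restrict_space (distr (unif_ball n) (borel_vec n) (normalize_vec n)) (unit_sphere n)"
  unfolding uniform_sphere_def normalize_vec_def ..

lemma space_uniform_sphere: "space (uniform_sphere n) = unit_sphere n"
  using unit_sphere_sets[THEN sets.sets_into_space]
  by (auto simp: uniform_sphere_alt space_restrict_space)

lemma measure_uniform_sphere_le_1: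
  assumes "n \<ge> 1"
  shows "measure (uniform_sphere n) X \<le> 1"
proof (cases "X \<in> sets (uniform_sphere n)")
  case True
  interpret prob_space "unif_ball n" by (rule prob_space_unif_ball[OF assms])
  interpret D: prob_space "distr (unif_ball n) (borel_vec n) (normalize_vec n)"
    by (rule prob_space_distr) simp
  have "X \<subseteq> unit_sphere n" using sets.sets_into_space[OF True] by (simp add: space_uniform_sphere)
  then show ?thesis
    unfolding uniform_sphere_alt using unit_sphere_sets[of n]
    by (subst measure_restrict_space) (auto intro: sets.Int)
next
  case False
  then show ?thesis by (simp add: measure_notin_sets)
qed

text \<open>
  Transfer of a scale-invariant event from the ball to the sphere. The event has to be measurable: a
  set that is not measurable has \<open>measure\<close> zero, whatever it contains.
\<close>
lemma uniform_sphere_prob_ge: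
  assumes n: "n \<ge> 1" and Q: "{x \<in> space (leb n). Q x} \<in> sets (leb n)"
    and cone: "\<And>x a. x \<in> space (leb n) \<Longrightarrow> a > 0 \<Longrightarrow> Q (shrink n a x) \<longleftrightarrow> Q x"
    and bad: "emeasure (unif_ball n) {x \<in> space (leb n). \<not> Q x \<and> 0 < sqnorm n x} \<le> ennreal \<delta>" "0 \<le> \<delta>"
  shows "measure (uniform_sphere n) {b \<in> space (uniform_sphere n). Q (coords n b)} \<ge> 1 - \<delta>"
proof -
  interpret prob_space "unif_ball n" by (rule prob_space_unif_ball[OF n])
  let ?E = "{b \<in> carrier_vec n. Q (coords n b)} \<inter> unit_sphere n"
  let ?P = "normalize_vec n -` ?E \<inter> space (leb n)"
  let ?B = "{x \<in> space (leb n). \<not> Q x \<and> 0 < sqnorm n x}" and ?Z = "{x \<in> space (leb n). \<not> 0 < sqnorm n x}"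
  have E: "?E \<in> sets (borel_vec n)"
    using sets_borel_vec_coords[OF Q] unit_sphere_sets by (rule sets.Int)
  have "measure (uniform_sphere n) {b \<in> space (uniform_sphere n). Q (coords n b)}
     = measure (uniform_sphere n) ?E"
    unfolding space_uniform_sphere by (rule arg_cong[of _ _ "measure _"]) (auto simp: unit_sphere_def)
  also have "\<dots> = measure (distr (unif_ball n) (borel_vec n) (normalize_vec n)) ?E"
    unfolding uniform_sphere_alt using unit_sphere_sets[of n]
    by (intro measure_restrict_space) (auto intro: sets.Int)
  also have "\<dots> = prob ?P"
    using E by (subst measure_distr) auto
  finally have eq: "measure (uniform_sphere n) {b \<in> space (uniform_sphere n). Q (coords n b)} = prob ?P" .
  have P: "?P \<in> sets (leb n)" by (rule measurable_sets[OF normalize_vec_measurable E])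
  have Z: "?Z \<in> sets (leb n)" by measurable
  have B: "?B \<in> sets (leb n)"
  proof -
    have "?B = (space (leb n) - {x \<in> space (leb n). Q x}) \<inter> {x \<in> space (leb n). 0 < sqnorm n x}" by auto
    also have "\<dots> \<in> sets (leb n)" using Q by measurable
    finally show ?thesis .
  qed
  have "space (leb n) \<subseteq> ?P \<union> ?B \<union> ?Z"
  proof
    fix x assume x: "x \<in> space (leb n)"
    show "x \<in> ?P \<union> ?B \<union> ?Z"
    proof (cases "Q x \<and> 0 < sqnorm n x")
      case True
      let ?a = "sqrt (sqnorm n x)"
      have a: "?a > 0" using True by simp
      have "sqnorm n (shrink n ?a x) = (\<Sum>i<n. (x i)\<^sup>2 / ?a\<^sup>2)"
        by (intro sum.cong) (auto simp: shrink_def power_divide)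
      also have "\<dots> = sqnorm n x / ?a\<^sup>2" by (simp add: sum_divide_distrib)
      also have "\<dots> = 1" using True by simp
      finally have "normalize_vec n x \<in> unit_sphere n"
        by (simp add: unit_sphere_coords coords_normalize_vec normalize_vec_carrier)
      moreover have "Q (coords n (normalize_vec n x))"
        using cone[OF x a] True by (simp add: coords_normalize_vec)
      ultimately show ?thesis using x by (simp add: unit_sphere_def)
    qed (use x in auto)
  qed
  then have "prob (space (leb n)) \<le> prob (?P \<union> ?B \<union> ?Z)"
    using P B Z by (intro finite_measure_mono) auto
  also have "\<dots> \<le> prob (?P \<union> ?B) + prob ?Z"
    using P B Z by (intro measure_Un_le) auto
  also have "prob (?P \<union> ?B) \<le> prob ?P + prob ?B"
    using P B Z by (intro measure_Un_le) auto
  also have "prob ?Z = 0"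
  proof -
    have "{x \<in> space (leb n). 0 < sqnorm n x \<and> sqnorm n x \<le> 1} \<inter> ?Z = {}" by auto
    then have Z0: "emeasure (unif_ball n) ?Z = 0"
      unfolding emeasure_uniform_measure[OF ball_sets Z] by (simp only: emeasure_empty) simp
    show ?thesis unfolding measure_def Z0 by simp
  qed
  also have "prob ?B \<le> \<delta>"
    using bad by (simp add: emeasure_eq_measure)
  also have "prob (space (leb n)) = 1" using prob_space by simp
  finally show ?thesis using eq by simp
qed

lemma worst_error_prob_ge:
  assumes "n \<ge> 1" "A \<in> sym_mats n" "error_prob n A m i t \<ge> p"
  shows "worst_error_prob n m i t \<ge> p"
proof -
  have "error_prob n A m i t \<le> worst_error_prob n m i t"
    unfolding worst_error_prob_def
    by (rule cSUP_upper[OF assms(2)])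
      (auto intro!: bdd_aboveI[of _ 1] measure_uniform_sphere_le_1[OF assms(1)] simp: error_prob_def)
  then show ?thesis using assms(3) by simp
qed

section \<open>The error of the largest Ritz value\<close>

text \<open>
  The condition of \<open>ritz_1_le_iff\<close> as a property of the coordinates of the start vector.
\<close>
definition form_nonneg :: "nat \<Rightarrow> nat \<Rightarrow> (nat \<Rightarrow> real) \<Rightarrow> real \<Rightarrow> (nat \<Rightarrow> real) \<Rightarrow> bool" where
  "form_nonneg n m d s x \<longleftrightarrow> (\<forall>c. 0 \<le> (\<Sum>j<n. (s - d j) * ((\<Sum>k<m. c k * d j ^ k) * x j)\<^sup>2))"

text \<open>
  The form is continuous in the coefficients, so the uncountable quantifier over them can be replaced
  by one over a countable dense set.
\<close>
lemma form_nonneg_sets: "{x \<in> space (leb n). form_nonneg n m d s x} \<in> sets (leb n)"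
proof -
  define G where "G = (\<lambda>c x. \<Sum>j<n. (s - d j) * ((\<Sum>k<m. c k * d j ^ k) * x j)\<^sup>2)"
  obtain D :: "(nat \<Rightarrow> real) set" where D: "countable D" "\<And>X. open X \<Longrightarrow> X \<noteq> {} \<Longrightarrow> \<exists>c\<in>D. c \<in> X"
    using countable_dense_setE by blast
  have eq: "form_nonneg n m d s x \<longleftrightarrow> (\<forall>c\<in>D. 0 \<le> G c x)" for x
  proof
    assume *: "\<forall>c\<in>D. 0 \<le> G c x"
    show "form_nonneg n m d s x"
    proof (rule ccontr)
      assume "\<not> form_nonneg n m d s x"
      then have "{c. G c x < 0} \<noteq> {}" by (auto simp: form_nonneg_def G_def not_le)
      moreover have "open {c. G c x < 0}"
        unfolding G_def by (intro open_Collect_less continuous_intros continuous_on_product_coordinates)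
      ultimately show False using D(2) * by fastforce
    qed
  qed (auto simp: form_nonneg_def G_def)
  have [measurable]: "G c \<in> borel_measurable (leb n)" for c
    unfolding G_def by measurable
  have "{x \<in> space (leb n). \<forall>c\<in>D. 0 \<le> G c x} \<in> sets (leb n)"
    by (rule sets.sets_Collect_countable_All'[OF _ D(1)]) measurable
  then show ?thesis by (simp add: eq)
qed

lemma form_nonneg_shrink:
  assumes "a > 0"
  shows "form_nonneg n m d s (shrink n a x) \<longleftrightarrow> form_nonneg n m d s x"
proof -
  have "(\<Sum>j<n. (s - d j) * ((\<Sum>k<m. c k * d j ^ k) * shrink n a x j)\<^sup>2) =
      (\<Sum>j<n. (s - d j) * ((\<Sum>k<m. c k * d j ^ k) * x j)\<^sup>2) / a\<^sup>2" for c
    unfolding sum_divide_distrib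
    by (rule sum.cong) (auto simp: shrink_def power_divide power_mult_distrib)
  then show ?thesis using assms by (simp add: form_nonneg_def zero_le_divide_iff)
qed

lemma unit_sphere_nonzero: "b \<in> unit_sphere n \<Longrightarrow> b \<in> carrier_vec n \<and> b \<noteq> 0\<^sub>v n"
  by (auto simp: unit_sphere_def)

lemma error_event_top:
  assumes n: "n \<ge> 2" and m: "m \<ge> 1" and b: "b \<in> unit_sphere n"
    and mono: "\<And>j k. j \<le> k \<Longrightarrow> k < n \<Longrightarrow> d k \<le> d j" and lt: "d (n - 1) < d 0"
  shows "ritz_defined (mat_diag n d) b m 1 \<and> rel_error (mat_diag n d) b m 1 \<ge> t \<longleftrightarrow>
     form_nonneg n m d (d 0 - t * (d 0 - d (n - 1))) (coords n b)"
proof -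
  have bc: "b \<in> carrier_vec n" "b \<noteq> 0\<^sub>v n" using unit_sphere_nonzero[OF b] by auto
  have "rel_error (mat_diag n d) b m 1 = (d 0 - ritz (mat_diag n d) b m 1) / (d 0 - d (n - 1))"
    unfolding rel_error_def using n eigval_mat_diag[of n d, OF mono] by simp
  then have "rel_error (mat_diag n d) b m 1 \<ge> t \<longleftrightarrow> ritz (mat_diag n d) b m 1 \<le> d 0 - t * (d 0 - d (n - 1))"
    using lt by (auto simp: le_divide_eq algebra_simps)
  also have "\<dots> \<longleftrightarrow> form_nonneg n m d (d 0 - t * (d 0 - d (n - 1))) (coords n b)"
    unfolding ritz_1_le_iff(2)[OF bc m] form_nonneg_def
    by (intro all_cong1 arg_cong[of _ _ "\<lambda>z. 0 \<le> z"] sum.cong) (auto simp: coords_def)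
  finally show ?thesis using ritz_1_le_iff(1)[OF bc m] by blast
qed

text \<open>
  The block with index \<open>k\<close> carries the eigenvalue \<open>cheb_node r m k\<close>. The only negative term of the form
  belongs to the eigenvalue \<open>1\<close> and is bounded by the values of the polynomial at the nodes; the block
  sums dominate it once every block outweighs the coordinate \<open>0\<close> by the factor \<open>1 / \<beta>\<close>.
\<close>
lemma blocks_form_nonneg:
  fixes x d :: "nat \<Rightarrow> real"
  assumes m: "m \<ge> 1" and r: "0 < r" "r \<le> 1" and N: "1 + m * N \<le> n"
    and d0: "d 0 = 1" and s: "1 - t \<le> s"
    and dJ: "\<And>k j. k < m \<Longrightarrow> j \<in> {1 + k * N..<1 + (k + 1) * N} \<Longrightarrow> d j = cheb_node r m k"
    and gap: "\<And>j. 1 \<le> j \<Longrightarrow> j < n \<Longrightarrow> g \<le> s - d j"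
    and g: "0 \<le> g" and t: "0 \<le> t"
    and \<beta>: "\<beta> * t * (4 * real m * cheb_growth r ^ (2 * m)) \<le> g"
    and x: "\<And>k. k < m \<Longrightarrow> (x 0)\<^sup>2 \<le> \<beta> * (\<Sum>j\<in>{1 + k * N..<1 + (k + 1) * N}. (x j)\<^sup>2)"
  shows "form_nonneg n m d s x"
  unfolding form_nonneg_def
proof
  fix c :: "nat \<Rightarrow> real"
  let ?J = "\<lambda>k. {1 + k * N..<1 + (k + 1) * N}"
  let ?L = "4 * real m * cheb_growth r ^ (2 * m)"
  define p where "p = (\<Sum>k<m. Polynomial.monom (c k) k)"
  have pz: "(\<Sum>k<m. c k * z ^ k) = poly p z" for z
    by (simp add: p_def poly_sum poly_monom)
  have deg: "degree p < m"
    unfolding p_def by (rule degree_sum_less) (use m degree_monom_le in \<open>auto intro: le_less_trans\<close>)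
  let ?T = "\<lambda>j. (s - d j) * (poly p (d j) * x j)\<^sup>2"
  let ?P = "\<lambda>k. (poly p (cheb_node r m k))\<^sup>2"
  have L0: "0 \<le> ?L" using cheb_growth_ge_1[OF r] by simp
  have J1: "?J k \<subseteq> {1..<n}" if "k < m" for k
  proof -
    have "(k + 1) * N \<le> m * N" using that by (intro mult_right_mono) auto
    then show ?thesis using N by auto
  qed
  have disj: "?J k \<inter> ?J l = {}" if "k < l" for k l
  proof -
    have "(k + 1) * N \<le> l * N" using that by (intro mult_right_mono) auto
    then show ?thesis by auto
  qed
  have "(\<Sum>k<m. g * ?P k * (\<Sum>j\<in>?J k. (x j)\<^sup>2)) \<le> (\<Sum>k<m. \<Sum>j\<in>?J k. ?T j)"
  proof (rule sum_mono)
    fix k assume "k \<in> {..<m}"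
    then have k: "k < m" by simp
    have "g * ?P k * (\<Sum>j\<in>?J k. (x j)\<^sup>2) = (\<Sum>j\<in>?J k. g * (poly p (d j) * x j)\<^sup>2)"
      unfolding sum_distrib_left
      by (rule sum.cong) (use dJ[OF k] in \<open>auto simp: power_mult_distrib mult.assoc\<close>)
    also have "\<dots> \<le> (\<Sum>j\<in>?J k. ?T j)"
      by (intro sum_mono mult_right_mono gap) (use J1[OF k] in auto)
    finally show "g * ?P k * (\<Sum>j\<in>?J k. (x j)\<^sup>2) \<le> (\<Sum>j\<in>?J k. ?T j)" .
  qed
  also have "\<dots> = (\<Sum>j\<in>(\<Union>k<m. ?J k). ?T j)"
    by (rule sum.UNION_disjoint[symmetric]) (use disj in \<open>auto simp: neq_iff\<close>)
  also have "\<dots> \<le> (\<Sum>j\<in>{1..<n}. ?T j)"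
  proof (rule sum_mono2)
    show "(\<Union>k<m. ?J k) \<subseteq> {1..<n}" using J1 by blast
    fix j assume "j \<in> {1..<n} - (\<Union>k<m. ?J k)"
    then have "g \<le> s - d j" using gap by auto
    then show "0 \<le> ?T j" using g by simp
  qed simp
  finally have rest: "(\<Sum>k<m. g * ?P k * (\<Sum>j\<in>?J k. (x j)\<^sup>2)) \<le> (\<Sum>j\<in>{1..<n}. ?T j)" .
  have "t * (poly p 1 * x 0)\<^sup>2 = t * (x 0)\<^sup>2 * (poly p 1)\<^sup>2" by (simp add: power_mult_distrib)
  also have "\<dots> \<le> t * (x 0)\<^sup>2 * (?L * (\<Sum>k<m. ?P k))"
    using cheb_extrapolation[OF r m deg] t by (intro mult_left_mono) auto
  also have "\<dots> = (\<Sum>k<m. t * ?L * ?P k * (x 0)\<^sup>2)"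
    by (simp add: sum_distrib_left mult_ac)
  also have "\<dots> \<le> (\<Sum>k<m. g * ?P k * (\<Sum>j\<in>?J k. (x j)\<^sup>2))"
  proof (rule sum_mono)
    fix k assume "k \<in> {..<m}"
    then have k: "k < m" by simp
    let ?W = "\<Sum>j\<in>?J k. (x j)\<^sup>2"
    have "t * ?L * ?P k * (x 0)\<^sup>2 \<le> t * ?L * ?P k * (\<beta> * ?W)"
      using x[OF k] t L0 by (intro mult_left_mono) auto
    also have "\<dots> = (\<beta> * t * ?L) * (?P k * ?W)" by (simp only: mult_ac)
    also have "\<dots> \<le> g * (?P k * ?W)"
      using \<beta> by (intro mult_right_mono mult_nonneg_nonneg sum_nonneg) simp_all
    finally show "t * ?L * ?P k * (x 0)\<^sup>2 \<le> g * ?P k * ?W" by (simp add: mult.assoc)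
  qed
  finally have top: "t * (poly p 1 * x 0)\<^sup>2 \<le> (\<Sum>k<m. g * ?P k * (\<Sum>j\<in>?J k. (x j)\<^sup>2))" .
  have "(s - 1) * (poly p 1 * x 0)\<^sup>2 \<ge> - t * (poly p 1 * x 0)\<^sup>2"
    using s by (intro mult_right_mono) auto
  then have "?T 0 \<ge> - t * (poly p 1 * x 0)\<^sup>2" by (simp only: d0)
  moreover have "(\<Sum>j<n. ?T j) = ?T 0 + (\<Sum>j\<in>{1..<n}. ?T j)"
  proof -
    have "{..<n} = insert 0 {1..<n}" using N by auto
    then show ?thesis by simp
  qed
  ultimately show "0 \<le> (\<Sum>j<n. (s - d j) * ((\<Sum>k<m. c k * d j ^ k) * x j)\<^sup>2)"
    using rest top unfolding pz by linarith
qed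

text \<open>
  The matrix has the simple eigenvalue \<open>1\<close>, and the Chebyshev nodes of \<open>[0, r]\<close> as eigenvalues of
  multiplicity at least \<open>N\<close>. A start vector for which the largest Ritz value comes close to \<open>1\<close>
  must have a coordinate \<open>0\<close> that dominates one of the \<open>m\<close> blocks.
\<close>
lemma worst_error_prob_top_ge:
  assumes m: "m \<ge> 1" and r: "0 < r" and g: "0 < g" and t: "0 \<le> t" and rgt: "r + g + t \<le> 1"
    and N: "N = (n - 1) div m" "N \<ge> 1" and \<beta>0: "0 \<le> \<beta>"
    and \<beta>: "\<beta> * t * (4 * real m * cheb_growth r ^ (2 * m)) \<le> g"
  shows "worst_error_prob n m 1 t \<ge> 1 - real m * (2 / sqrt (1 + 3 / 4 * \<beta>) ^ N)"
proof -
  have mN: "m * N \<le> n - 1" using N(1) by simp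
  moreover have "m \<le> m * N" using N(2) by simp
  ultimately have n: "n \<ge> 2" using m by linarith
  have mN1: "1 + m * N \<le> n" using mN n by linarith
  have r1: "r \<le> 1" using rgt g t by linarith
  \<comment> \<open>The minimum sends the coordinates left over by the division to the last block.\<close>
  define grp where "grp = (\<lambda>j. min ((j - 1) div N) (m - 1))"
  define d where "d = (\<lambda>j. if j = 0 then 1 else cheb_node r m (grp j))"
  have grp_lt: "grp j < m" for j using m by (simp add: grp_def min_less_iff_disj)
  have node: "0 \<le> cheb_node r m k" "cheb_node r m k \<le> r" for k using cheb_node_bounds[of r] r by auto
  have mono: "d k \<le> d j" if "j \<le> k" for j k
  proof (cases "j = 0")
    case True
    then show ?thesis using node r1 by (auto simp: d_def intro: order_trans)
  next
    case False
    have "grp j \<le> grp k" unfolding grp_def using that by (intro min.mono div_le_mono) auto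
    then have "cheb_node r m (grp k) \<le> cheb_node r m (grp j)"
      using cheb_node_less[OF r _ grp_lt, of "grp j" k] by (cases "grp j = grp k") (auto intro: less_imp_le)
    then show ?thesis using False that by (simp add: d_def)
  qed
  \<comment> \<open>The smallest eigenvalue need not be 0; the spread 1 - dn is at most 1, which only enlarges the relative error.\<close>
  define dn where "dn = d (n - 1)"
  have dn: "0 \<le> dn" "dn \<le> r" using n node by (auto simp: dn_def d_def)
  have d0: "d 0 = 1" by (simp add: d_def)
  define s where "s = 1 - t * (1 - dn)"
  have s: "1 - t \<le> s" using t dn by (simp add: s_def mult_left_le)
  let ?J = "\<lambda>k. {1 + k * N..<1 + (k + 1) * N}"
  define B where "B = (\<lambda>k. {x \<in> space (leb n). (x 0)\<^sup>2 > \<beta> * (\<Sum>j\<in>?J k. (x j)\<^sup>2)})"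
  let ?\<delta> = "2 / sqrt (1 + 3 / 4 * \<beta>) ^ N"
  have J: "?J k \<subseteq> {1..<n}" if "k < m" for k
  proof -
    have "(k + 1) * N \<le> m * N" using that by (intro mult_right_mono) auto
    then show ?thesis using mN1 by auto
  qed
  have dJ: "d j = cheb_node r m k" if "k < m" "j \<in> ?J k" for k j
  proof -
    have "(j - 1) div N = k" using that(2) N(2) by (intro div_nat_eqI) (auto simp: algebra_simps)
    then show ?thesis using that by (auto simp: d_def grp_def)
  qed
  have det: "form_nonneg n m d s x" if x: "x \<in> space (leb n) - (\<Union>k<m. B k)" for x
  proof (rule blocks_form_nonneg[where d = d, OF m r r1 mN1 d0 s])
    show "g \<le> s - d j" if "1 \<le> j" for j
      using that node[of "grp j"] s rgt by (auto simp: d_def)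
  qed (use dJ g t \<beta> x in \<open>auto simp: B_def not_less\<close>)
  have "error_prob n (mat_diag n d) m 1 t \<ge> 1 - real m * ?\<delta>"
  proof -
    have "{b \<in> space (uniform_sphere n). ritz_defined (mat_diag n d) b m 1 \<and> t \<le> rel_error (mat_diag n d) b m 1}
        = {b \<in> space (uniform_sphere n). form_nonneg n m d s (coords n b)}"
    proof -
      have "d (n - 1) < d 0" using dn r1 rgt g t by (simp add: d0 dn_def)
      then have "ritz_defined (mat_diag n d) b m 1 \<and> t \<le> rel_error (mat_diag n d) b m 1
          \<longleftrightarrow> form_nonneg n m d s (coords n b)" if "b \<in> unit_sphere n" for b
        using error_event_top[where d = d and t = t, OF n m that] mono by (simp add: s_def dn_def d0)
      then show ?thesis unfolding space_uniform_sphere by blast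
    qed
    moreover have "measure (uniform_sphere n) {b \<in> space (uniform_sphere n). form_nonneg n m d s (coords n b)} \<ge> 1 - real m * ?\<delta>"
    proof (rule uniform_sphere_prob_ge[OF _ form_nonneg_sets form_nonneg_shrink])
      have Bs: "B k \<in> sets (leb n)" if "k < m" for k
        unfolding B_def using n by (intro dominated_event_sets J[OF that]) simp
      have "emeasure (unif_ball n) {x \<in> space (leb n). \<not> form_nonneg n m d s x \<and> 0 < sqnorm n x}
          \<le> emeasure (unif_ball n) (\<Union>k<m. B k)"
      proof (rule emeasure_mono)
        show "{x \<in> space (leb n). \<not> form_nonneg n m d s x \<and> 0 < sqnorm n x} \<subseteq> (\<Union>k<m. B k)"
          using det by blast
        have "(\<Union>k<m. B k) \<in> sets (leb n)" using Bs by (intro sets.finite_UN) auto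
        then show "(\<Union>k<m. B k) \<in> sets (unif_ball n)" by simp
      qed
      also have "\<dots> \<le> (\<Sum>k<m. emeasure (unif_ball n) (B k))"
        by (rule emeasure_subadditive_finite) (use Bs in auto)
      also have "\<dots> \<le> (\<Sum>k<m. ennreal ?\<delta>)"
      proof (rule sum_mono)
        fix k assume "k \<in> {..<m}"
        then have "?J k \<subseteq> {1..<n}" using J by simp
        moreover have "card (?J k) = N" by simp
        ultimately show "emeasure (unif_ball n) (B k) \<le> ennreal ?\<delta>"
          unfolding B_def using unif_ball_dominated_le[of n "?J k" \<beta>] n \<beta>0 by simp
      qed
      also have "\<dots> = ennreal (real m * ?\<delta>)"
      proof -
        have "0 \<le> ?\<delta>" using \<beta>0 by simp
        then have "(\<Sum>k<m. ennreal ?\<delta>) = ennreal (\<Sum>k<m. ?\<delta>)" by (intro sum_ennreal)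
        then show ?thesis by (simp only: sum_constant card_lessThan)
      qed
      finally show "emeasure (unif_ball n) {x \<in> space (leb n). \<not> form_nonneg n m d s x \<and> 0 < sqnorm n x}
          \<le> ennreal (real m * ?\<delta>)" .
    qed (use n \<beta>0 in auto)
    ultimately show ?thesis unfolding error_prob_def by simp
  qed
  then show ?thesis using worst_error_prob_ge[OF _ mat_diag_sym] n by simp
qed

section \<open>The error of the lower Ritz values\<close>

text \<open>
  The matrix has the eigenvalues \<open>0, 1, \<dots>, i - 1\<close>, and the largest one is repeated so that
  \<open>\<lambda>\<^sub>1 = \<lambda>\<^sub>i = i - 1\<close>. The Krylov subspace has at most one dimension for each eigenvalue, so whenever the
  \<open>i\<close>-th Ritz value exists it is \<open>0\<close>, the smallest eigenvalue, and the relative error is \<open>1\<close>. It exists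
  as soon as no entry of the start vector vanishes.
\<close>
lemma worst_error_prob_higher:
  assumes i: "i \<ge> 2" and m: "i \<le> m" and n: "2 * i \<le> n" and t: "t \<le> 1"
  shows "worst_error_prob n m i t \<ge> 1"
proof -
  \<comment> \<open>Decreasing in the index, with the value i - 1 on at least i indices and the value 0 at the last one.\<close>
  define g where "g = (\<lambda>j. min (i - 1) (n - 1 - j))"
  have gi: "g j < i" for j using i by (simp add: g_def min_less_iff_disj)
  let ?A = "mat_diag n (\<lambda>j. real (g j))"
  define Q where "Q = (\<lambda>x::nat \<Rightarrow> real. \<forall>k<i. \<exists>j<n. g j = k \<and> x j \<noteq> 0)"
  have Qs: "{x \<in> space (leb n). Q x} \<in> sets (leb n)"
  proof -
    note coord_measurable [measurable]
    have 1: "{x \<in> space (leb n). x j \<noteq> 0} \<in> sets (leb n)" if "j < n" for j using that by measurable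
    have "{x \<in> space (leb n). Q x} = {x \<in> space (leb n). \<forall>k\<in>{..<i}. \<exists>j\<in>{j. j < n \<and> g j = k}. x j \<noteq> 0}"
      by (auto simp: Q_def)
    also have "\<dots> \<in> sets (leb n)"
      by (intro sets.sets_Collect_finite_All' sets.sets_Collect_finite_Ex) (use 1 i in \<open>auto simp: lessThan_empty_iff\<close>)
    finally show ?thesis .
  qed
  have mono: "real (g k) \<le> real (g j)" if "j \<le> k" for j k using that by (auto simp: g_def)
  have event: "ritz_defined ?A b m i \<and> t \<le> rel_error ?A b m i \<longleftrightarrow> Q (coords n b)"
    if b: "b \<in> unit_sphere n" for b
  proof -
    have bc: "b \<in> carrier_vec n" using unit_sphere_nonzero[OF b] by simp
    have "eigval ?A i = real (i - 1)" "eigval ?A 1 = real (i - 1)" "eigval ?A n = 0"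
      using eigval_mat_diag[of n "\<lambda>j. real (g j)", OF mono] i n by (auto simp: g_def)
    then have rel: "rel_error ?A b m i = (real (i - 1) - ritz ?A b m i) / real (i - 1)"
      by (simp add: rel_error_def)
    have "t \<le> rel_error ?A b m i" if def: "ritz_defined ?A b m i"
    proof -
      have "ritz ?A b m i \<le> 0" by (rule ritz_groups(2)[OF bc gi _ m def]) (use i in auto)
      then have "1 \<le> rel_error ?A b m i" unfolding rel using i by (simp add: le_divide_eq)
      then show ?thesis using t by simp
    qed
    moreover have "ritz_defined ?A b m i \<longleftrightarrow> Q (coords n b)"
      using ritz_groups(1)[OF bc gi _ m] i by (auto simp: Q_def coords_def)
    ultimately show ?thesis by blast
  qed
  have "measure (uniform_sphere n) {b \<in> space (uniform_sphere n). Q (coords n b)} \<ge> 1 - 0"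
  proof (rule uniform_sphere_prob_ge[OF _ Qs])
    show "n \<ge> 1" using i n by simp
    show "Q (shrink n a x) \<longleftrightarrow> Q x" if "a > 0" for a x
      unfolding Q_def using that by (intro all_cong ex_cong) (auto simp: shrink_def)
    let ?Z = "\<lambda>j. {x \<in> space (leb n). x j = 0}"
    let ?B = "{x \<in> space (leb n). \<not> Q x \<and> 0 < sqnorm n x}"
    have Zs: "?Z j \<in> null_sets (leb n)" if j: "j < n" for j
    proof -
      have [measurable]: "(\<lambda>x. x j) \<in> borel_measurable (leb n)" by (rule coord_measurable[OF j])
      have "?Z j \<in> sets (leb n)" by measurable
      then show ?thesis using emeasure_coord_zero[OF j] by auto
    qed
    have Bs: "?B \<in> sets (leb n)"
    proof -
      have "?B = (space (leb n) - {x \<in> space (leb n). Q x}) \<inter> {x \<in> space (leb n). 0 < sqnorm n x}" by auto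
      also have "\<dots> \<in> sets (leb n)" using Qs by measurable
      finally show ?thesis .
    qed
    have "(\<Union>j<n. ?Z j) \<in> null_sets (leb n)" using Zs by (intro null_sets_UN') auto
    moreover have "?B \<subseteq> (\<Union>j<n. ?Z j)"
    proof
      fix x assume x: "x \<in> ?B"
      then obtain k where k: "k < i" "\<And>j. j < n \<Longrightarrow> g j = k \<Longrightarrow> x j = 0" unfolding Q_def by blast
      have "n - 1 - k < n" "g (n - 1 - k) = k" using k(1) n by (auto simp: g_def)
      then show "x \<in> (\<Union>j<n. ?Z j)" using k(2) x by blast
    qed
    ultimately have B0: "?B \<in> null_sets (leb n)" using Bs null_sets_subset by blast
    let ?S = "{x \<in> space (leb n). 0 < sqnorm n x \<and> sqnorm n x \<le> 1}"
    have "?S \<inter> ?B \<in> null_sets (leb n)" using B0 ball_sets[of n] by (rule null_set_Int1)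
    then have "emeasure (leb n) (?S \<inter> ?B) = 0" by auto
    then show "emeasure (unif_ball n) ?B \<le> ennreal 0"
      using Bs by (simp add: emeasure_uniform_measure[OF ball_sets])
  qed auto
  moreover have "{b \<in> space (uniform_sphere n). ritz_defined ?A b m i \<and> t \<le> rel_error ?A b m i}
      = {b \<in> space (uniform_sphere n). Q (coords n b)}"
    using event by (auto simp: space_uniform_sphere)
  ultimately have "error_prob n ?A m i t \<ge> 1" unfolding error_prob_def by simp
  then show ?thesis using worst_error_prob_ge[OF _ mat_diag_sym] i n by simp
qed

section \<open>Asymptotic consequences\<close>

text \<open>
  The constant \<open>48\<close> makes each of the \<open>m\<close> blocks fail with probability at most \<open>2 / n\<^sup>3\<close>, so that the
  union over \<open>m \<le> n\<close> blocks leaves \<open>2 / n\<^sup>2 = o(1/n)\<close>: the blocks have size \<open>N \<ge> n / (2 m)\<close> and the Chernoff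
  factor of a coordinate is at least \<open>exp (\<beta> / 8)\<close>.
\<close>
lemma chernoff_factor_ge:
  assumes m: "m \<ge> 1" and n: "n \<ge> 3" and mn: "48 * real m * ln n \<le> real n"
  shows "(n - 1) div m \<ge> 1"
    "real n ^ 3 \<le> sqrt (1 + 3 / 4 * (48 * real m * ln n / n)) ^ ((n - 1) div m)"
proof -
  define \<beta> where "\<beta> = 48 * real m * ln n / n"
  define N where "N = (n - 1) div m"
  have "exp 1 \<le> real n" using exp_le n by linarith
  then have ln1: "1 \<le> ln (real n)" using n by (simp add: ln_ge_iff)
  then have "48 * real m * 1 \<le> 48 * real m * ln n" by (intro mult_left_mono) auto
  then have m48: "48 * real m \<le> real n" using mn by linarith
  have \<beta>: "0 \<le> \<beta>" "\<beta> \<le> 1" using mn n ln1 by (auto simp: \<beta>_def divide_le_eq)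
  have "n - 1 < (N + 1) * m"
    using dividend_less_div_times[of m "n - 1"] m by (simp add: N_def)
  then have "n \<le> (N + 1) * m" by linarith
  then have "real n \<le> (real N + 1) * real m" by (metis of_nat_1 of_nat_add of_nat_le_iff of_nat_mult)
  then have Nm: "real n \<le> real N * real m * 2"
    using m48 by (simp add: algebra_simps)
  then show "(n - 1) div m \<ge> 1" using n by (cases "N = 0") (auto simp: N_def)
  have "exp (\<beta> / 4) \<le> 1 + \<beta> / 4 + (\<beta> / 4)\<^sup>2" using \<beta> by (intro exp_bound) auto
  also have "(\<beta> / 4)\<^sup>2 \<le> \<beta> / 4"
    using mult_left_le[of \<beta> \<beta>] \<beta> by (simp add: power2_eq_square)
  finally have "exp (\<beta> / 4) \<le> 1 + 3 / 4 * \<beta>" using \<beta> by linarith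
  moreover have "exp (\<beta> / 4) = (exp (\<beta> / 8))\<^sup>2" by (simp add: power2_eq_square exp_add[symmetric])
  ultimately have e: "exp (\<beta> / 8) \<le> sqrt (1 + 3 / 4 * \<beta>)" by (simp add: real_le_rsqrt)
  have "real n ^ 3 = exp (3 * ln n)" using n by (simp add: exp_of_nat_mult[of 3, simplified])
  also have "3 * ln n \<le> real N * (\<beta> / 8)"
  proof -
    have "real n * (3 * ln n) \<le> real N * real m * 2 * (3 * ln n)"
      using Nm ln1 by (intro mult_right_mono) auto
    then show ?thesis using n by (simp add: \<beta>_def field_simps)
  qed
  then have "exp (3 * ln n) \<le> exp (real N * (\<beta> / 8))" by simp
  also have "\<dots> = exp (\<beta> / 8) ^ N" by (rule exp_of_nat_mult)
  also have "\<dots> \<le> sqrt (1 + 3 / 4 * \<beta>) ^ N" using e by (intro power_mono) auto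
  finally show "real n ^ 3 \<le> sqrt (1 + 3 / 4 * (48 * real m * ln n / n)) ^ ((n - 1) div m)"
    by (simp add: \<beta>_def N_def)
qed

text \<open>
  The two conditions on \<open>n\<close> say that the blocks are longer than a multiple of \<open>ln n\<close>, and that the
  extrapolation factor does not exceed what the multiplicities of the nodes compensate.
\<close>
lemma worst_error_prob_top_large:
  fixes r g t :: real and m n :: nat
  assumes m: "m \<ge> 1" and n: "n \<ge> 3" and mn: "48 * real m * ln n \<le> real n"
    and r: "0 < r" and g: "0 < g" and t: "0 \<le> t" and rgt: "r + g + t \<le> 1"
    and L: "192 * (real m)\<^sup>2 * ln n * t * cheb_growth r ^ (2 * m) \<le> g * real n"
  shows "worst_error_prob n m 1 t \<ge> 1 - 2 / (real n)\<^sup>2"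
proof -
  define \<beta> where "\<beta> = 48 * real m * ln n / n"
  define R where "R = sqrt (1 + 3 / 4 * \<beta>) ^ ((n - 1) div m)"
  have R: "real n ^ 3 \<le> R" using chernoff_factor_ge(2)[OF m n mn] by (simp add: R_def \<beta>_def)
  have ln0: "0 < ln (real n)" using n by simp
  have "\<beta> * t * (4 * real m * cheb_growth r ^ (2 * m)) \<le> g"
    using L n by (simp add: \<beta>_def field_simps power2_eq_square)
  then have "worst_error_prob n m 1 t \<ge> 1 - real m * (2 / R)"
    unfolding R_def
    by (intro worst_error_prob_top_ge[OF m r g t rgt refl chernoff_factor_ge(1)[OF m n mn]])
      (use ln0 n in \<open>simp_all add: \<beta>_def\<close>)
  moreover have "real m * (2 / R) \<le> 2 / (real n)\<^sup>2"
  proof -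
    have "exp 1 \<le> real n" using exp_le n by linarith
    then have "1 \<le> ln (real n)" using n by (simp add: ln_ge_iff)
    then have "48 * real m * 1 \<le> 48 * real m * ln n" by (intro mult_left_mono) auto
    then have "real m \<le> real n" using mn by linarith
    moreover have "0 < real n ^ 3" using n by simp
    moreover from this have "0 < R" using R by linarith
    ultimately have "real m * (2 / R) \<le> real n * (2 / real n ^ 3)"
      using R by (intro mult_mono divide_left_mono) auto
    also have "\<dots> = 2 / (real n)\<^sup>2" using n by (simp add: power2_eq_square power3_eq_cube)
    finally show ?thesis .
  qed
  ultimately show ?thesis by linarith
qed

lemma eventually_worst_error_prob:
  fixes m :: "nat \<Rightarrow> nat" and t :: "nat \<Rightarrow> real"
  assumes i: "i \<ge> 1" and mi: "\<And>n. n \<ge> 1 \<Longrightarrow> m n \<ge> i"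
    and t1: "\<forall>\<^sub>F n in sequentially. t n \<le> 1"
    and top: "\<forall>\<^sub>F n in sequentially. 48 * real (m n) * ln n \<le> real n \<and>
       (\<exists>r g :: real. 0 < r \<and> 0 < g \<and> 0 \<le> t n \<and> r + g + t n \<le> 1 \<and>
          192 * (real (m n))\<^sup>2 * ln n * t n * cheb_growth r ^ (2 * m n) \<le> g * real n)"
  shows "\<exists>\<eta> :: nat \<Rightarrow> real. \<eta> \<in> o(\<lambda>n. 1 / real n) \<and>
           (\<forall>\<^sub>F n in sequentially. worst_error_prob n (m n) i (t n) \<ge> 1 - \<eta> n)"
proof (intro exI conjI)
  show "(\<lambda>n. 2 / (real n)\<^sup>2) \<in> o(\<lambda>n. 1 / real n)" by real_asymp
  show "\<forall>\<^sub>F n in sequentially. worst_error_prob n (m n) i (t n) \<ge> 1 - 2 / (real n)\<^sup>2"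
  proof (cases "i = 1")
    case True
    show ?thesis
      using top eventually_ge_at_top[of 3]
    proof eventually_elim
      case (elim n)
      then show ?case using worst_error_prob_top_large[of "m n" n _ _ "t n"] mi[of n] True by auto
    qed
  next
    case False
    show ?thesis
      using t1 eventually_ge_at_top[of "2 * i"]
    proof eventually_elim
      case (elim n)
      have "worst_error_prob n (m n) i (t n) \<ge> 1"
        using elim mi[of n] i False by (intro worst_error_prob_higher) auto
      moreover have "0 \<le> 2 / (real n)\<^sup>2" by simp
      ultimately show ?case by linarith
    qed
  qed
qed

lemma cheb_growth_le:
  assumes r: "0 < r" "r \<le> 1"
  shows "cheb_growth r \<le> 4 / r"
proof -
  define u where "u = sqrt (1 - r)"
  have u: "0 \<le> u" "u < 1" "r = (1 - u) * (1 + u)"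
    using r by (auto simp: u_def real_sqrt_lt_1_iff algebra_simps)
  have "cheb_growth r = (1 + u) / (1 - u)" by (simp add: cheb_growth_def u_def)
  then have "cheb_growth r * r = (1 + u) / (1 - u) * ((1 - u) * (1 + u))" using u(3) by simp
  also have "\<dots> = (1 + u)\<^sup>2" using u(2) by (simp add: power2_eq_square)
  also have "\<dots> \<le> 2\<^sup>2" using u by (intro power_mono) auto
  finally show ?thesis using r by (simp add: le_divide_eq)
qed

text \<open>
  For nodes in \<open>[0, 1 - 2 t]\<close> the point \<open>1\<close> is at distance at least \<open>2 t\<close>, and the growth per degree is
  \<open>1 + O(\<surd>t)\<close>. Up to \<open>t\<close> of order \<open>1 / m\<^sup>2\<close> extrapolation to \<open>1\<close> therefore costs a constant factor
  only.
\<close>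
lemma cheb_growth_near_1:
  assumes t: "0 \<le> t" "t \<le> 1 / 18"
  shows "cheb_growth (1 - 2 * t) ^ (2 * m) \<le> exp (9 * (real m * sqrt t))"
proof -
  define u where "u = sqrt (2 * t)"
  have "u \<le> sqrt (1 / 9)" unfolding u_def using t by (intro real_sqrt_le_mono) auto
  then have u: "0 \<le> u" "u \<le> 1 / 3" using t by (auto simp: u_def real_sqrt_divide)
  have "cheb_growth (1 - 2 * t) = (1 + u) / (1 - u)" by (simp add: cheb_growth_def u_def)
  also have "\<dots> \<le> 1 + 3 * u"
  proof -
    have "3 * u * u \<le> u" using mult_right_mono[of "3 * u" 1 u] u by simp
    then have "1 + u \<le> (1 + 3 * u) * (1 - u)" by (simp add: algebra_simps)
    then show ?thesis using u by (simp add: divide_le_eq)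
  qed
  also have "\<dots> \<le> exp (3 * u)" by (rule exp_ge_add_one_self)
  finally have "cheb_growth (1 - 2 * t) ^ (2 * m) \<le> exp (3 * u) ^ (2 * m)"
    using cheb_growth_ge_1[of "1 - 2 * t"] t by (intro power_mono) auto
  also have "\<dots> = exp (6 * (real m * u))" by (simp add: exp_of_nat_mult[symmetric])
  also have "\<dots> \<le> exp (9 * (real m * sqrt t))"
  proof -
    have "sqrt 2 \<le> 3 / 2" by (rule real_le_lsqrt) (auto simp: power2_eq_square)
    then have "real m * sqrt t * sqrt 2 \<le> real m * sqrt t * (3 / 2)" using t by (intro mult_left_mono) auto
    then show ?thesis by (simp add: u_def real_sqrt_mult mult_ac)
  qed
  finally show ?thesis .
qed

text \<open>
  Half of the distance between \<open>1\<close> and the nodes is the error, the other half is the gap by which the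
  nodes are kept away from the bound for the Ritz value.
\<close>
lemma eventually_worst_error_prob_small:
  fixes m :: "nat \<Rightarrow> nat" and t :: "nat \<Rightarrow> real"
  assumes i: "i \<ge> 1" and mi: "\<And>n. n \<ge> 1 \<Longrightarrow> m n \<ge> i"
    and t: "\<forall>\<^sub>F n in sequentially. 0 < t n \<and> t n \<le> 1 / 18"
    and bound: "\<forall>\<^sub>F n in sequentially.
       192 * (real (m n))\<^sup>2 * ln n * exp (9 * (real (m n) * sqrt (t n))) \<le> n"
  shows "\<exists>\<eta> :: nat \<Rightarrow> real. \<eta> \<in> o(\<lambda>n. 1 / real n) \<and>
           (\<forall>\<^sub>F n in sequentially. worst_error_prob n (m n) i (t n) \<ge> 1 - \<eta> n)"
proof (rule eventually_worst_error_prob[OF i mi])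
  show "\<forall>\<^sub>F n in sequentially. t n \<le> 1" using t by eventually_elim auto
  show "\<forall>\<^sub>F n in sequentially. 48 * real (m n) * ln n \<le> real n \<and>
       (\<exists>r g :: real. 0 < r \<and> 0 < g \<and> 0 \<le> t n \<and> r + g + t n \<le> 1 \<and>
          192 * (real (m n))\<^sup>2 * ln n * t n * cheb_growth r ^ (2 * m n) \<le> g * real n)"
    using t bound eventually_ge_at_top[of 1]
  proof eventually_elim
    case (elim n)
    let ?M = "real (m n)" and ?e = "exp (9 * (real (m n) * sqrt (t n)))"
    have ln0: "0 \<le> ln (real n)" using elim by simp
    have m1: "1 \<le> ?M" using mi[of n] i elim by simp
    have e1: "1 \<le> ?e" using elim by simp
    have "48 * ?M * ln n \<le> 192 * ?M\<^sup>2 * ln n * ?e"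
    proof -
      have "?M * 1 \<le> ?M * ?M" using m1 by (intro mult_left_mono) auto
      then have "48 * ?M \<le> 192 * ?M\<^sup>2" using m1 by (simp add: power2_eq_square)
      then have "48 * ?M * ln n \<le> 192 * ?M\<^sup>2 * ln n" using ln0 by (rule mult_right_mono)
      moreover have "192 * ?M\<^sup>2 * ln n * 1 \<le> 192 * ?M\<^sup>2 * ln n * ?e"
        using ln0 e1 by (intro mult_left_mono) auto
      ultimately show ?thesis by linarith
    qed
    moreover have "192 * ?M\<^sup>2 * ln n * t n * cheb_growth (1 - 2 * t n) ^ (2 * m n) \<le> t n * n"
    proof -
      have "192 * ?M\<^sup>2 * ln n * t n * cheb_growth (1 - 2 * t n) ^ (2 * m n)
          \<le> 192 * ?M\<^sup>2 * ln n * t n * ?e"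
        using elim ln0 cheb_growth_near_1[of "t n" "m n"] by (intro mult_left_mono) auto
      also have "\<dots> = t n * (192 * ?M\<^sup>2 * ln n * ?e)" by (simp only: mult_ac)
      also have "\<dots> \<le> t n * n" using elim by (intro mult_left_mono) auto
      finally show ?thesis .
    qed
    moreover have "0 < 1 - 2 * t n" "0 < t n" "0 \<le> t n" "1 - 2 * t n + t n + t n \<le> 1" using elim by auto
    ultimately show ?case using elim by (meson order_trans)
  qed
qed

text \<open>
  The nodes lie in \<open>[0, \<epsilon> / 2]\<close> and the growth per degree is at most \<open>8 / \<epsilon>\<close>. With \<open>\<epsilon> = \<surd>(m / ln n)\<close> the
  extrapolation factor \<open>(8 / \<epsilon>)\<^sup>2\<^sup>m \<le> exp (16 m / \<epsilon>) = exp (16 \<surd>(m ln n))\<close> is a small power of \<open>n\<close>.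
\<close>
lemma few_iterations:
  fixes m :: "nat \<Rightarrow> nat"
  assumes i: "i \<ge> 1" and mi: "\<And>n. n \<ge> 1 \<Longrightarrow> m n \<ge> i" and m: "(\<lambda>n. real (m n)) \<in> o(\<lambda>n. ln (real n))"
  shows "\<exists>\<epsilon> \<eta> :: nat \<Rightarrow> real. \<epsilon> \<in> o(\<lambda>n. 1) \<and> \<eta> \<in> o(\<lambda>n. 1 / real n) \<and>
          (\<forall>\<^sub>F n in sequentially. worst_error_prob n (m n) i (1 - \<epsilon> n) \<ge> 1 - \<eta> n)"
proof -
  define \<epsilon> where "\<epsilon> = (\<lambda>n. sqrt (real (m n) / ln (real n)))"
  have "(\<lambda>n. real (m n) / ln (real n)) \<longlonglongrightarrow> 0" using m by (rule smalloD_tendsto)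
  then have lim: "\<epsilon> \<longlonglongrightarrow> 0" unfolding \<epsilon>_def using tendsto_real_sqrt by fastforce
  have small: "\<epsilon> \<in> o(\<lambda>n. 1)" using lim by (intro smalloI_tendsto) auto
  have m4: "\<forall>\<^sub>F n in sequentially. real (m n) \<le> 1 / 4096 * ln (real n)"
  proof -
    have "\<forall>\<^sub>F n in sequentially. norm (real (m n)) \<le> 1 / 4096 * norm (ln (real n))"
      by (rule landau_o.smallD[OF m]) simp
    then show ?thesis using eventually_ge_at_top[of 1] by eventually_elim simp
  qed
  have asym: "\<forall>\<^sub>F n in sequentially. 384 * (ln (real n))\<^sup>2 * ln n * exp (ln n / 4) * sqrt (ln (real n)) \<le> n"
    by real_asymp
  have "\<exists>\<eta> :: nat \<Rightarrow> real. \<eta> \<in> o(\<lambda>n. 1 / real n) \<and>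
          (\<forall>\<^sub>F n in sequentially. worst_error_prob n (m n) i (1 - \<epsilon> n) \<ge> 1 - \<eta> n)"
  proof (rule eventually_worst_error_prob[OF i mi])
    show "\<forall>\<^sub>F n in sequentially. 1 - \<epsilon> n \<le> 1"
      using eventually_ge_at_top[of 1] by eventually_elim (simp add: \<epsilon>_def)
    have ev1: "\<forall>\<^sub>F n in sequentially. \<epsilon> n < 1" using lim by (rule order_tendstoD) simp
    show "\<forall>\<^sub>F n in sequentially. 48 * real (m n) * ln n \<le> real n \<and>
       (\<exists>r g :: real. 0 < r \<and> 0 < g \<and> 0 \<le> 1 - \<epsilon> n \<and> r + g + (1 - \<epsilon> n) \<le> 1 \<and>
          192 * (real (m n))\<^sup>2 * ln n * (1 - \<epsilon> n) * cheb_growth r ^ (2 * m n) \<le> g * real n)"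
      using m4 asym ev1 eventually_ge_at_top[of 3]
    proof eventually_elim
      case (elim n)
      let ?M = "real (m n)" and ?l = "ln (real n)" and ?e = "\<epsilon> n"
      have "exp 1 \<le> real n" using exp_le elim by linarith
      then have l1: "1 \<le> ?l" using elim by (simp add: ln_ge_iff)
      have m1: "1 \<le> ?M" using mi[of n] i elim by simp
      have e0: "0 < ?e" using m1 l1 by (simp add: \<epsilon>_def)
      have ml: "?M \<le> ?l" using elim l1 by linarith
      have inv_e: "1 \<le> ?e * sqrt ?l"
      proof -
        have "?e * sqrt ?l = sqrt ?M" using l1 by (simp add: \<epsilon>_def real_sqrt_mult[symmetric])
        then show ?thesis using m1 by simp
      qed
      have growth: "cheb_growth (?e / 2) ^ (2 * m n) \<le> exp (?l / 4)"
      proof -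
        have "cheb_growth (?e / 2) \<le> 8 / ?e" using cheb_growth_le[of "?e / 2"] e0 elim by simp
        also have "\<dots> \<le> exp (8 / ?e)" using exp_ge_add_one_self[of "8 / ?e"] by linarith
        finally have "cheb_growth (?e / 2) ^ (2 * m n) \<le> exp (8 / ?e) ^ (2 * m n)"
          using cheb_growth_ge_1[of "?e / 2"] e0 elim by (intro power_mono) auto
        also have "\<dots> = exp (16 * (?M / ?e))" by (simp add: exp_of_nat_mult[symmetric] mult_ac)
        also have "\<dots> \<le> exp (?l / 4)"
        proof -
          have "(64 * sqrt ?M)\<^sup>2 \<le> (sqrt ?l)\<^sup>2" using elim l1 m1 by (simp add: power_mult_distrib)
          then have "64 * sqrt ?M \<le> sqrt ?l" using l1 by (intro power2_le_imp_le[of "64 * sqrt ?M"]) auto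
          then have "64 * sqrt ?M * sqrt ?l \<le> sqrt ?l * sqrt ?l" using l1 by (intro mult_right_mono) auto
          then have "64 * (sqrt ?M * sqrt ?l) \<le> ?l" using l1 by simp
          moreover have "?M / ?e = sqrt ?M * sqrt ?l"
            using m1 l1 by (simp add: \<epsilon>_def real_sqrt_divide field_simps)
          ultimately show ?thesis by simp
        qed
        finally show ?thesis .
      qed
      have "192 * ?M\<^sup>2 * ?l * (1 - ?e) * cheb_growth (?e / 2) ^ (2 * m n) \<le> 192 * ?l\<^sup>2 * ?l * 1 * exp (?l / 4)"
        using m1 ml l1 e0 elim growth cheb_growth_ge_1[of "?e / 2"]
        by (intro mult_mono power_mono mult_nonneg_nonneg) auto
      also have "\<dots> \<le> 192 * ?l\<^sup>2 * ?l * exp (?l / 4) * (?e * sqrt ?l)"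
        using mult_left_mono[OF inv_e, of "192 * ?l\<^sup>2 * ?l * exp (?l / 4)"] l1 by simp
      also have "\<dots> = (?e / 2) * (384 * ?l\<^sup>2 * ?l * exp (?l / 4) * sqrt ?l)" by simp
      also have "\<dots> \<le> (?e / 2) * n" using elim e0 by (intro mult_left_mono) auto
      finally have main: "192 * ?M\<^sup>2 * ?l * (1 - ?e) * cheb_growth (?e / 2) ^ (2 * m n) \<le> (?e / 2) * n" .
      have "48 * ?M * ?l \<le> 384 * ?l\<^sup>2 * ?l * exp (?l / 4) * sqrt ?l"
      proof -
        have "1 \<le> exp (?l / 4)" "1 \<le> sqrt ?l" using l1 by auto
        then have "?l\<^sup>2 * ?l * 1 * 1 \<le> ?l\<^sup>2 * ?l * exp (?l / 4) * sqrt ?l"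
          using l1 by (intro mult_mono) auto
        moreover have "?M * ?l \<le> ?l\<^sup>2 * ?l"
          using ml l1 m1 mult_mono[of ?M "?l\<^sup>2" ?l ?l] self_le_power[of ?l 2] by simp
        moreover have "0 \<le> ?l\<^sup>2 * ?l" using l1 by simp
        ultimately have "48 * (?M * ?l) \<le> 384 * (?l\<^sup>2 * ?l * exp (?l / 4) * sqrt ?l)" by linarith
        then show ?thesis by (simp only: mult.assoc)
      qed
      moreover have "0 < ?e / 2" "0 \<le> 1 - ?e" "?e / 2 + ?e / 2 + (1 - ?e) \<le> 1" using e0 elim by auto
      ultimately show ?case using main elim by (meson order_trans)
    qed
  qed
  then show ?thesis using small by blast
qed

text \<open>
  Here \<open>m \<surd>t\<close> is \<open>\<surd>0.015 ln n / ln (ln n)\<close>, so the extrapolation factor is \<open>n\<^sup>o\<^sup>(\<^sup>1\<^sup>)\<close>.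
\<close>
lemma logarithmic_iterations:
  fixes m :: "nat \<Rightarrow> nat"
  assumes i: "i \<ge> 1" and mi: "\<And>n. n \<ge> 1 \<Longrightarrow> m n \<ge> i" and m: "(\<lambda>n. real (m n)) \<in> \<Theta>(\<lambda>n. ln (real n))"
  shows "\<exists>\<eta> :: nat \<Rightarrow> real. \<eta> \<in> o(\<lambda>n. 1 / real n) \<and>
          (\<forall>\<^sub>F n in sequentially.
             worst_error_prob n (m n) i
               (0.015 * (ln (real n))\<^sup>2 / ((real (m n))\<^sup>2 * (ln (ln (real n)))\<^sup>2)) \<ge> 1 - \<eta> n)"
proof (rule eventually_worst_error_prob_small[OF i mi])
  obtain C where C: "C > 0" "\<forall>\<^sub>F n in sequentially. norm (real (m n)) \<le> C * norm (ln (real n))"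
    using bigthetaD1[OF m] by (elim landau_o.bigE)
  obtain c where c: "c > 0" "\<forall>\<^sub>F n in sequentially. norm (real (m n)) \<ge> c * norm (ln (real n))"
    using bigthetaD2[OF m] by (elim landau_omega.bigE)
  let ?t = "\<lambda>n. 0.015 * (ln (real n))\<^sup>2 / ((real (m n))\<^sup>2 * (ln (ln (real n)))\<^sup>2)"
  have a1: "\<forall>\<^sub>F n in sequentially. 0.015 / c\<^sup>2 / (ln (ln (real n)))\<^sup>2 \<le> 1 / 18" using c(1) by real_asymp
  have a2: "\<forall>\<^sub>F n in sequentially. 192 * (C * ln (real n))\<^sup>2 * ln n * exp (9 / 8 * (ln (real n) / ln (ln (real n)))) \<le> n"
    using C(1) by real_asymp
  have l1: "\<forall>\<^sub>F n in sequentially. ln (ln (real n)) > 0" by real_asymp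
  have t_eq: "\<forall>\<^sub>F n in sequentially. 0 < ?t n \<and> ?t n \<le> 1 / 18 \<and>
     real (m n) * sqrt (?t n) \<le> 1 / 8 * (ln (real n) / ln (ln (real n)))"
    using c(2) a1 l1 eventually_ge_at_top[of 3]
  proof eventually_elim
    case (elim n)
    let ?M = "real (m n)" and ?l = "ln (real n)" and ?ll = "ln (ln (real n))"
    have "exp 1 \<le> real n" using exp_le elim by linarith
    then have l: "1 \<le> ?l" using elim by (simp add: ln_ge_iff)
    have M: "1 \<le> ?M" using mi[of n] i elim by simp
    have cl: "0 < c * ?l" "c * ?l \<le> ?M" using elim c(1) l by auto
    have "?t n \<le> 0.015 * ?l\<^sup>2 / ((c * ?l)\<^sup>2 * ?ll\<^sup>2)"
      using cl c(1) elim l M by (intro divide_left_mono mult_right_mono power_mono mult_pos_pos zero_less_power) auto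
    also have "\<dots> = 0.015 / c\<^sup>2 / ?ll\<^sup>2" using l by (simp add: power_mult_distrib)
    finally have "?t n \<le> 1 / 18" using elim by simp
    moreover have "0 < ?t n" using l M elim by (intro divide_pos_pos mult_pos_pos) auto
    moreover have "?M * sqrt (?t n) \<le> 1 / 8 * (?l / ?ll)"
    proof -
      have "sqrt (?t n) = sqrt 0.015 * ?l / (?M * ?ll)"
        using l M elim by (simp add: real_sqrt_divide real_sqrt_mult)
      then have "?M * sqrt (?t n) = sqrt 0.015 * (?l / ?ll)" using M by simp
      also have "\<dots> \<le> 1 / 8 * (?l / ?ll)"
      proof (rule mult_right_mono)
        show "sqrt 0.015 \<le> (1 / 8 :: real)" by (rule real_le_lsqrt) (auto simp: power2_eq_square)
      qed (use l elim in simp)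
      finally show ?thesis .
    qed
    ultimately show ?case by blast
  qed
  then show "\<forall>\<^sub>F n in sequentially. 0 < ?t n \<and> ?t n \<le> 1 / 18" by eventually_elim auto
  show "\<forall>\<^sub>F n in sequentially. 192 * (real (m n))\<^sup>2 * ln n * exp (9 * (real (m n) * sqrt (?t n))) \<le> n"
    using t_eq C(2) a2 eventually_ge_at_top[of 3]
  proof eventually_elim
    case (elim n)
    have l: "0 \<le> ln (real n)" using elim by simp
    have "192 * (real (m n))\<^sup>2 * ln n * exp (9 * (real (m n) * sqrt (?t n)))
       \<le> 192 * (C * ln (real n))\<^sup>2 * ln n * exp (9 / 8 * (ln (real n) / ln (ln (real n))))"
      using elim l C(1) by (intro mult_mono power_mono) auto
    then show ?case using elim by linarith
  qed
qed

text \<open>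
  Here \<open>m \<surd>t = \<surd>1.08\<close>, so the extrapolation factor is constant and the requirement that remains is
  that \<open>m\<^sup>2 ln n\<close> is at most a small multiple of \<open>n\<close>.
\<close>
lemma many_iterations:
  fixes m :: "nat \<Rightarrow> nat"
  assumes i: "i \<ge> 1" and mi: "\<And>n. n \<ge> 1 \<Longrightarrow> m n \<ge> i"
    and m: "(\<lambda>n. real (m n)) \<in> o(\<lambda>n. real n powr (1/2) * ln (real n) powr (-1/2))"
    and inf: "(\<lambda>n. real (m n)) \<in> \<omega>(\<lambda>n. 1)"
  shows "\<exists>\<eta> :: nat \<Rightarrow> real. \<eta> \<in> o(\<lambda>n. 1 / real n) \<and>
          (\<forall>\<^sub>F n in sequentially. worst_error_prob n (m n) i (1.08 / (real (m n))\<^sup>2) \<ge> 1 - \<eta> n)"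
proof (rule eventually_worst_error_prob_small[OF i mi])
  have m5: "\<forall>\<^sub>F n in sequentially. real (m n) \<ge> 5"
    using landau_omega.smallD[OF inf, of 5] by simp
  define \<kappa> where "\<kappa> = 192 * exp (9 * sqrt 1.08)"
  have \<kappa>: "\<kappa> > 0" by (simp add: \<kappa>_def)
  show "\<forall>\<^sub>F n in sequentially. 0 < 1.08 / (real (m n))\<^sup>2 \<and> 1.08 / (real (m n))\<^sup>2 \<le> 1 / 18"
    using m5
  proof eventually_elim
    case (elim n)
    then have "5\<^sup>2 \<le> (real (m n))\<^sup>2" by (intro power_mono) auto
    then show ?case using elim by (simp add: divide_le_eq)
  qed
  have "\<forall>\<^sub>F n in sequentially. norm (real (m n)) \<le> 1 / sqrt \<kappa> * norm (real n powr (1/2) * ln (real n) powr (-1/2))"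
    by (rule landau_o.smallD[OF m]) (use \<kappa> in simp)
  then show "\<forall>\<^sub>F n in sequentially.
     192 * (real (m n))\<^sup>2 * ln n * exp (9 * (real (m n) * sqrt (1.08 / (real (m n))\<^sup>2))) \<le> n"
    using m5 eventually_ge_at_top[of 3]
  proof eventually_elim
    case (elim n)
    have l: "0 < ln (real n)" using elim by simp
    have "real (m n) \<le> 1 / sqrt \<kappa> * (sqrt n * (1 / sqrt (ln n)))"
      using elim l by (simp add: powr_half_sqrt powr_minus_divide)
    then have "(real (m n))\<^sup>2 \<le> (1 / sqrt \<kappa> * (sqrt n * (1 / sqrt (ln n))))\<^sup>2" by (intro power_mono) auto
    also have "\<dots> = n / (\<kappa> * ln n)" using \<kappa> l by (simp add: power_mult_distrib power_divide)
    finally have "\<kappa> * (real (m n))\<^sup>2 * ln n \<le> n" using \<kappa> l by (simp add: field_simps)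
    moreover have "real (m n) * sqrt (1.08 / (real (m n))\<^sup>2) = sqrt 1.08"
    proof -
      have "sqrt (1.08 / (real (m n))\<^sup>2) = sqrt 1.08 / real (m n)"
        by (simp only: real_sqrt_divide real_sqrt_abs abs_of_nat)
      then show ?thesis using elim by simp
    qed
    ultimately show ?case by (simp add: \<kappa>_def mult_ac)
  qed
qed

theorem corollary5p1:
  fixes i :: nat and m :: "nat \<Rightarrow> nat"
  assumes "i \<ge> 1" and "\<And>n. n \<ge> 1 \<Longrightarrow> m n \<ge> i"
  shows
    "((\<lambda>n. real (m n)) \<in> o(\<lambda>n. ln (real n)) \<longrightarrow>
       (\<exists>\<epsilon> \<eta> :: nat \<Rightarrow> real. \<epsilon> \<in> o(\<lambda>n. 1) \<and> \<eta> \<in> o(\<lambda>n. 1 / real n) \<and>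
          (\<forall>\<^sub>F n in sequentially. worst_error_prob n (m n) i (1 - \<epsilon> n) \<ge> 1 - \<eta> n)))
     \<and>
     ((\<lambda>n. real (m n)) \<in> \<Theta>(\<lambda>n. ln (real n)) \<longrightarrow>
       (\<exists>\<eta> :: nat \<Rightarrow> real. \<eta> \<in> o(\<lambda>n. 1 / real n) \<and>
          (\<forall>\<^sub>F n in sequentially.
             worst_error_prob n (m n) i
               (0.015 * (ln (real n))\<^sup>2 / ((real (m n))\<^sup>2 * (ln (ln (real n)))\<^sup>2)) \<ge> 1 - \<eta> n)))
     \<and>
     ((\<lambda>n. real (m n)) \<in> o(\<lambda>n. real n powr (1/2) * ln (real n) powr (-1/2)) \<longrightarrow>
      (\<lambda>n. real (m n)) \<in> \<omega>(\<lambda>n. 1) \<longrightarrow>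
       (\<exists>\<eta> :: nat \<Rightarrow> real. \<eta> \<in> o(\<lambda>n. 1 / real n) \<and>
          (\<forall>\<^sub>F n in sequentially.
             worst_error_prob n (m n) i (1.08 / (real (m n))\<^sup>2) \<ge> 1 - \<eta> n)))"
  using few_iterations[where m = m, OF assms] logarithmic_iterations[where m = m, OF assms]
    many_iterations[where m = m, OF assms]
  by blast

end
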